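(* Let $A_5$ be the alternating group on $\{1,2,3,4,5\}$, acted on by $S_5$ via conjugation. Then: (1) every $4$-valent type I regular balanced Cayley map on $A_5$ is isomorphic to $\mathcal{CM}_{(123)}^{(1425)}$; (2) every $6$-valent type I regular balanced Cayley map on $A_5$ is isomorphic to $\mathcal{CM}_{(123)}^{(12)(345)}$; (3) for $n>3$ there does not exist a $2n$-valent type I regular balanced Cayley map on $A_5$.
   Context: Let $\Gamma$ be a finite group and $\Omega\subseteq\Gamma$ a generating set with $1\notin\Omega$ and $\Omega^{-1}=\Omega$. The Cayley graph $\mathrm{Cay}(\Gamma,\Omega)$ has vertex set $\Gamma$ and arcs $(\eta,\omega)\in\Gamma\times\Omega$ from $\eta$ to $\eta\omega$. A cyclic permutation $\rho$ of $\Omega$ gives a cyclic order on the arcs leaving each vertex via $(\eta,\omega)\mapsto(\eta,\rho(\omega))$, which determines a cellular embedding of $\mathrm{Cay}(\Gamma,\Omega)$ into a closed oriented surface; this is the Cayley map $\mathcal{CM}(\Gamma,\Omega,\rho)$. An isomorphism of Cayley maps is an isomorphism of the underlying graphs compatible with the cyclic orders. The map is regular if its automorphism group acts transitively on arcs, and balanced if $\rho(\omega^{-1})=\rho(\omega)^{-1}$ for all $\omega\in\Omega$; write RBCM for regular balanced Cayley map. Its valency is $\#\Omega$. In an RBCM all elements of $\Omega$ have the same order; it is of type I if they are not involutions (then $\#\Omega=2n$ and, writing $\Omega=\{\omega_1,\dots,\omega_{2n}\}$ with $\rho(\omega_i)=\omega_{i+1}$, one has $\omega_{i+n}=\omega_i^{-1}$),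 and of type II if all elements of $\Omega$ are involutions. Notation: for $\sigma\in S_5$ and $\omega\in A_5$, $\mathcal{CM}_{\omega}^{\sigma}$ denotes the Cayley map $\mathcal{CM}(A_5,\Omega,\rho)$ with $\Omega=\{\sigma^i\omega\sigma^{-i}:1\le i\le m\}$ ($m$ the number of distinct such conjugates) and $\rho(\sigma^i\omega\sigma^{-i})=\sigma^{i+1}\omega\sigma^{-(i+1)}$. Permutations are composed left to right: $\omega\psi$ means first apply $\omega$, then $\psi$ (e.g. $(12)(23)=(132)$). *)

theory Defs
  imports
    "HOL-Algebra.Sym_Groups"
    "HOL-Algebra.Generated_Groups"
    "HOL-Algebra.Multiplicative_Group"
    "HOL-Combinatorics.Orbits"
    "HOL-Combinatorics.Cycles"
    "Graph_Theory.Digraph"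
    "Graph_Theory.Digraph_Isomorphism"
begin

section \<open>Cayley maps\<close>

record 'a cayley_data =
  cm_group :: "'a monoid"
  cm_gens :: "'a set"
  cm_rot :: "'a \<Rightarrow> 'a"

definition CM :: "'a monoid \<Rightarrow> 'a set \<Rightarrow> ('a \<Rightarrow> 'a) \<Rightarrow> 'a cayley_data" where
  "CM G \<Omega> \<rho> = \<lparr> cm_group = G, cm_gens = \<Omega>, cm_rot = \<rho> \<rparr>"

definition cayley_map :: "'a cayley_data \<Rightarrow> bool" where
  "cayley_map M \<longleftrightarrow>
     group (cm_group M) \<and> finite (carrier (cm_group M)) \<and>
     cm_gens M \<subseteq> carrier (cm_group M) \<and>
     generate (cm_group M) (cm_gens M) = carrier (cm_group M) \<and>
     one (cm_group M) \<notin> cm_gens M \<and>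
     m_inv (cm_group M) ` cm_gens M = cm_gens M \<and>
     cm_rot M permutes cm_gens M \<and> cyclic_on (cm_rot M) (cm_gens M)"

definition cayley_graph :: "'a monoid \<Rightarrow> 'a set \<Rightarrow> ('a, 'a \<times> 'a) pre_digraph" where
  "cayley_graph G \<Omega> =
     \<lparr> verts = carrier G, arcs = carrier G \<times> \<Omega>,
       tail = fst, head = (\<lambda>(\<eta>, \<omega>). \<eta> \<otimes>\<^bsub>G\<^esub> \<omega>) \<rparr>"

abbreviation cm_graph :: "'a cayley_data \<Rightarrow> ('a, 'a \<times> 'a) pre_digraph" where
  "cm_graph M \<equiv> cayley_graph (cm_group M) (cm_gens M)"

definition arc_rot :: "'a cayley_data \<Rightarrow> 'a \<times> 'a \<Rightarrow> 'a \<times> 'a" where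
  "arc_rot M = (\<lambda>(\<eta>, \<omega>). (\<eta>, cm_rot M \<omega>))"

text \<open>
  The Cayley graph is a symmetric digraph without multiple arcs: the arc \<open>(\<eta>, \<omega>)\<close> and its
  reverse \<open>(\<eta>\<omega>, \<omega>\<inverse>)\<close> form one edge. As an arc is determined by its two ends, a digraph
  isomorphism automatically respects arc reversal, so digraph isomorphisms of Cayley graphs are
  isomorphisms of the underlying undirected graphs.
\<close>

lemma graph_cm_graph:
  assumes "cayley_map M"
  shows "graph (cm_graph M)"
proof -
  define G where "G = cm_group M"
  define W where "W = cm_gens M"
  interpret group G using assms by (simp add: cayley_map_def G_def)
  have fin: "finite (carrier G)" and sub: "W \<subseteq> carrier G" and one: "\<one>\<^bsub>G\<^esub> \<notin> W"
    and inv: "m_inv G ` W = W"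
    using assms by (auto simp: cayley_map_def G_def W_def)
  have W: "w \<in> carrier G" "w \<noteq> \<one>\<^bsub>G\<^esub>" "inv\<^bsub>G\<^esub> w \<in> W" if "w \<in> W" for w
    using that sub one inv by auto
  have sym: "symmetric (cayley_graph G W)"
    unfolding symmetric_def
  proof (rule symI)
    fix u v
    assume "(u, v) \<in> arcs_ends (cayley_graph G W)"
    then obtain w where w: "u \<in> carrier G" "w \<in> W" "v = u \<otimes>\<^bsub>G\<^esub> w"
      by (auto simp: arcs_ends_def arc_to_ends_def cayley_graph_def)
    have "(v, inv\<^bsub>G\<^esub> w) \<in> arcs (cayley_graph G W)"
      using w W[OF w(2)] by (simp add: cayley_graph_def)
    moreover have "arc_to_ends (cayley_graph G W) (v, inv\<^bsub>G\<^esub> w) = (v, u)"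
      using w W[OF w(2)] by (simp add: arc_to_ends_def cayley_graph_def m_assoc)
    ultimately show "(v, u) \<in> arcs_ends (cayley_graph G W)"
      unfolding arcs_ends_def by (metis imageI)
  qed
  have "graph (cayley_graph G W)"
  proof (unfold_locales, goal_cases)
    case (1 e) then show ?case by (auto simp: cayley_graph_def)
  next
    case (2 e) then show ?case using W by (auto simp: cayley_graph_def)
  next
    case 3 then show ?case using fin by (simp add: cayley_graph_def)
  next
    case 4 then show ?case using fin sub finite_subset by (auto simp: cayley_graph_def)
  next
    case (5 e)
    then obtain u w where e: "e = (u, w)" "u \<in> carrier G" "w \<in> W" by (auto simp: cayley_graph_def)
    have "u \<noteq> u \<otimes>\<^bsub>G\<^esub> w" using e W[of w] l_cancel_one[of u w] by auto
    then show ?case using e by (simp add: cayley_graph_def)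
  next
    case (6 e1 e2) then show ?case using W by (auto simp: cayley_graph_def arc_to_ends_def)
  next
    case 7 show ?case by (rule sym)
  qed
  then show ?thesis by (simp add: G_def W_def)
qed

definition cm_isomorphism ::
  "'a cayley_data \<Rightarrow> 'b cayley_data \<Rightarrow> ('a, 'a \<times> 'a, 'b, 'b \<times> 'b) digraph_isomorphism \<Rightarrow> bool" where
  "cm_isomorphism M N \<phi> \<longleftrightarrow>
     pre_digraph.digraph_isomorphism (cm_graph M) \<phi> \<and>
     app_iso \<phi> (cm_graph M) = cm_graph N \<and>
     (\<forall>a \<in> arcs (cm_graph M). iso_arcs \<phi> (arc_rot M a) = arc_rot N (iso_arcs \<phi> a))"

definition cm_isomorphic :: "'a cayley_data \<Rightarrow> 'b cayley_data \<Rightarrow> bool" where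
  "cm_isomorphic M N \<longleftrightarrow> cayley_map M \<and> cayley_map N \<and> (\<exists>\<phi>. cm_isomorphism M N \<phi>)"

definition regular :: "'a cayley_data \<Rightarrow> bool" where
  "regular M \<longleftrightarrow>
     (\<forall>a \<in> arcs (cm_graph M). \<forall>b \<in> arcs (cm_graph M).
        \<exists>\<phi>. cm_isomorphism M M \<phi> \<and> iso_arcs \<phi> a = b)"

definition balanced :: "'a cayley_data \<Rightarrow> bool" where
  "balanced M \<longleftrightarrow>
     (\<forall>\<omega> \<in> cm_gens M. cm_rot M (inv\<^bsub>cm_group M\<^esub> \<omega>) = inv\<^bsub>cm_group M\<^esub> (cm_rot M \<omega>))"

definition RBCM :: "'a cayley_data \<Rightarrow> bool" where
  "RBCM M \<longleftrightarrow> cayley_map M \<and> regular M \<and> balanced M"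

definition type_I :: "'a cayley_data \<Rightarrow> bool" where
  "type_I M \<longleftrightarrow> (\<forall>\<omega> \<in> cm_gens M. group.ord (cm_group M) \<omega> \<noteq> 2)"

definition valency :: "'a cayley_data \<Rightarrow> nat" where
  "valency M = card (cm_gens M)"


section \<open>The groups \<open>A\<^sub>5\<close> and \<open>S\<^sub>5\<close>\<close>

text \<open>
  Permutations are composed from left to right, so the multiplication is opposite to that of
  \<^const>\<open>sym_group\<close> and \<^const>\<open>alt_group\<close>.
\<close>

definition S5 :: "(nat \<Rightarrow> nat) monoid" where
  "S5 = (sym_group 5) \<lparr> mult := (\<lambda>\<pi> \<psi>. \<psi> \<circ> \<pi>) \<rparr>"

definition A5 :: "(nat \<Rightarrow> nat) monoid" where
  "A5 = (alt_group 5) \<lparr> mult := (\<lambda>\<pi> \<psi>. \<psi> \<circ> \<pi>) \<rparr>"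

lemma "cycle_of_list [1, 2] \<otimes>\<^bsub>S5\<^esub> cycle_of_list [2, 3] = cycle_of_list [1, 3, 2]"
  by (auto simp: S5_def transpose_def fun_eq_iff)

definition conj_S5 :: "(nat \<Rightarrow> nat) \<Rightarrow> (nat \<Rightarrow> nat) \<Rightarrow> (nat \<Rightarrow> nat)" where
  "conj_S5 \<sigma> \<omega> = \<sigma> \<otimes>\<^bsub>S5\<^esub> \<omega> \<otimes>\<^bsub>S5\<^esub> inv\<^bsub>S5\<^esub> \<sigma>"

definition conj_orbit :: "(nat \<Rightarrow> nat) \<Rightarrow> (nat \<Rightarrow> nat) \<Rightarrow> (nat \<Rightarrow> nat) set" where
  "conj_orbit \<sigma> \<omega> = {conj_S5 (\<sigma> [^]\<^bsub>S5\<^esub> i) \<omega> | i :: nat. True}"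

text \<open>
  All exponents are allowed in \<^const>\<open>conj_orbit\<close>: the sequence of conjugates is periodic, so
  \<open>i = 1, \<dots>, m\<close> gives the same set, where \<open>m\<close> is the number of distinct conjugates.
  The rotation maps \<open>\<sigma>\<^sup>i \<omega> \<sigma>\<^sup>-\<^sup>i\<close> to its conjugate by \<open>\<sigma>\<close>. As \<^const>\<open>cayley_map\<close> requires a permutation
  of the generating set, it is taken to be the identity elsewhere.
\<close>

definition CM_conj :: "(nat \<Rightarrow> nat) \<Rightarrow> (nat \<Rightarrow> nat) \<Rightarrow> (nat \<Rightarrow> nat) cayley_data" where
  "CM_conj \<sigma> \<omega> = CM A5 (conj_orbit \<sigma> \<omega>) (perm_restrict (conj_S5 \<sigma>) (conj_orbit \<sigma> \<omega>))"

end

theory Submission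
  imports Defs "HOL-Combinatorics.Multiset_Permutations"
begin

text \<open>
  An automorphism of a balanced Cayley map acts on the arcs at each vertex by a power of \<open>\<rho>\<close>;
  balancedness forces this power to be the same at both ends of every edge, hence everywhere. So if
  the map is regular, the automorphism that fixes the vertex \<open>1\<close> and rotates its arcs by one step is
  a group automorphism extending \<open>\<rho>\<close>.

  Every automorphism of \<open>A\<^sub>5\<close> is conjugation by some \<open>\<sigma> \<in> S\<^sub>5\<close>: it maps \<open>(123), (124), (125)\<close> to three
  3-cycles with pairwise products of order 2, and these are simultaneously conjugate to the
  original ones. Hence \<open>\<Omega>\<close> is one orbit of \<open>\<sigma>\<close>, so its size divides the order of \<open>\<sigma>\<close>, which is at most 6,
  and \<open>\<sigma>\<^sup>n\<close> inverts \<open>\<omega> \<in> \<Omega>\<close> when \<open>\<Omega>\<close> has \<open>2n\<close> elements. For \<open>n = 2\<close> and \<open>n = 3\<close> all such pairs \<open>(\<sigma>, \<omega>)\<close>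
  for which \<open>\<Omega>\<close> is not commutative are conjugate in \<open>S\<^sub>5\<close>, and conjugate pairs give isomorphic maps.
\<close>

section \<open>Regular balanced Cayley maps and group automorphisms\<close>

text \<open>The powers of \<open>f\<close> below the first return time \<open>d\<close> of
  \<open>x\<close> enumerate its orbit without repetition, so \<open>d\<close> is the size of
  \<open>S\<close>. The value of \<open>f ^^ n\<close> at \<open>x\<close> depends only on
  \<open>n mod d\<close>.\<close>

lemma cyclic_on_funpow_eq_iff:
  assumes "cyclic_on f S" "x \<in> S"
  shows "(f ^^ n) x = x \<longleftrightarrow> card S dvd n"
proof -
  define d where "d = funpow_dist1 f x x"
  have S: "S = orbit f x" using assms by (simp add: orbit_cyclic_eq3)
  then have x: "x \<in> orbit f x" using assms by simp
  have card: "card S = d"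
    using orbit_conv_funpow_dist1[OF x] inj_on_funpow_dist1[OF x] by (simp add: S d_def card_image)
  have d: "(f ^^ d) x = x" unfolding d_def using x by (rule funpow_dist1_prop)
  then have mod: "(f ^^ n) x = (f ^^ (n mod d)) x" by (simp add: funpow_mod_eq)
  show ?thesis
  proof (cases "n mod d = 0")
    case True
    then show ?thesis using mod card by (simp add: dvd_eq_mod_eq_0)
  next
    case False
    moreover have "n mod d < d" by (simp add: d_def)
    ultimately have "(f ^^ (n mod d)) x \<noteq> x" unfolding d_def by (intro funpow_dist1_least) auto
    then show ?thesis using False mod card by (simp add: dvd_eq_mod_eq_0)
  qed
qed

lemma cyclic_on_obtain_funpow:
  assumes "cyclic_on f S" "x \<in> S" "y \<in> S"
  obtains n where "y = (f ^^ n) x"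
  using assms by (auto simp: orbit_cyclic_eq3[OF assms(1,2), symmetric] orbit_altdef)

lemma RBCM_automorphism:
  assumes "RBCM M"
  obtains f where "f \<in> iso (cm_group M) (cm_group M)"
    and "\<And>w. w \<in> cm_gens M \<Longrightarrow> f w = cm_rot M w"
proof -
  define G where "G = cm_group M"
  define W where "W = cm_gens M"
  define r where "r = cm_rot M"
  have "cayley_map M" and reg: "regular M" and "balanced M"
    using assms by (auto simp: RBCM_def)
  then interpret group G by (simp add: cayley_map_def G_def)
  have sub: "W \<subseteq> carrier G" and gen: "generate G W = carrier G" and invW: "m_inv G ` W = W"
    and cyc: "cyclic_on r W"
    using \<open>cayley_map M\<close> by (auto simp: cayley_map_def G_def W_def r_def)
  have bal: "r (inv\<^bsub>G\<^esub> w) = inv\<^bsub>G\<^esub> (r w)" if "w \<in> W" for w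
    using \<open>balanced M\<close> that by (simp add: balanced_def G_def W_def r_def)
  have arcs: "arcs (cm_graph M) = carrier G \<times> W" and verts: "verts (cm_graph M) = carrier G"
    and tail: "tail (cm_graph M) = fst" and head: "head (cm_graph M) = (\<lambda>(\<eta>, \<omega>). \<eta> \<otimes>\<^bsub>G\<^esub> \<omega>)"
    by (simp_all add: cayley_graph_def G_def W_def)
  have inW: "w \<in> carrier G" "inv\<^bsub>G\<^esub> w \<in> W" "r w \<in> W" if "w \<in> W" for w
    using that sub invW cyclic_on_inI[OF cyc] by auto
  obtain w0 where w0: "w0 \<in> W" using cyc by (auto simp: cyclic_on_def)
  obtain \<phi> where \<phi>: "cm_isomorphism M M \<phi>" and \<phi>0: "iso_arcs \<phi> (\<one>\<^bsub>G\<^esub>, w0) = (\<one>\<^bsub>G\<^esub>, r w0)"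
    using reg w0 inW(3)[OF w0] unfolding regular_def arcs by (metis SigmaI one_closed)
  define F where "F = iso_verts \<phi>"
  \<comment> \<open>\<open>K u\<close> is the permutation of \<open>\<Omega>\<close> by which \<open>\<phi>\<close> acts on the arcs leaving \<open>u\<close>; it is a power of \<open>\<rho>\<close>.\<close>
  define K where "K u w = snd (iso_arcs \<phi> (u, w))" for u w
  have \<phi>1: "inj_on F (carrier G)"
      "\<And>a. a \<in> carrier G \<times> W \<Longrightarrow> F (fst a) = iso_tail \<phi> (iso_arcs \<phi> a)"
      "\<And>a. a \<in> carrier G \<times> W \<Longrightarrow> F (fst a \<otimes>\<^bsub>G\<^esub> snd a) = iso_head \<phi> (iso_arcs \<phi> a)"
    using \<phi> unfolding cm_isomorphism_def pre_digraph.digraph_isomorphism_def arcs verts tail head F_def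
    by (auto simp: case_prod_beta)
  have app: "app_iso \<phi> (cm_graph M) = cm_graph M" using \<phi> by (simp add: cm_isomorphism_def)
  have \<phi>2: "F ` carrier G = carrier G" "iso_arcs \<phi> ` (carrier G \<times> W) = carrier G \<times> W"
      "iso_tail \<phi> = fst" "iso_head \<phi> = (\<lambda>(\<eta>, \<omega>). \<eta> \<otimes>\<^bsub>G\<^esub> \<omega>)"
    using arg_cong[OF app, of verts] arg_cong[OF app, of arcs] arg_cong[OF app, of tail]
      arg_cong[OF app, of head]
    by (simp_all add: arcs verts tail head F_def)
  have Fc: "F u \<in> carrier G" if "u \<in> carrier G" for u using \<phi>2(1) that by blast
  have A: "iso_arcs \<phi> (u, w) = (F u, K u w)" if "u \<in> carrier G" "w \<in> W" for u w
    using \<phi>1(2)[of "(u, w)"] that by (simp add: \<phi>2 K_def)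
  have KW: "K u w \<in> W" if "u \<in> carrier G" "w \<in> W" for u w
    using \<phi>2(2) A[OF that] that by (metis SigmaD2 SigmaI image_eqI)
  have Fm: "F (u \<otimes>\<^bsub>G\<^esub> w) = F u \<otimes>\<^bsub>G\<^esub> K u w" if "u \<in> carrier G" "w \<in> W" for u w
    using \<phi>1(3)[of "(u, w)"] that A[OF that] by (simp add: \<phi>2)
  have Kr: "K u (r w) = r (K u w)" if "u \<in> carrier G" "w \<in> W" for u w
  proof -
    have "iso_arcs \<phi> (arc_rot M (u, w)) = arc_rot M (iso_arcs \<phi> (u, w))"
      using \<phi> that unfolding cm_isomorphism_def arcs by blast
    then show ?thesis using A that inW(3) by (simp add: arc_rot_def r_def)
  qed
  have Kn: "K u ((r ^^ n) w) = (r ^^ n) (K u w)" if "u \<in> carrier G" "w \<in> W" for u w n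
    by (induction n) (use that Kr cyclic_on_funpow_in[OF cyc] in auto)
  \<comment> \<open>\<open>K u\<close> commutes with \<open>r\<close>, which is transitive on the
    generators, so agreement with \<open>r\<close> at one generator spreads to all of them.\<close>
  have K_all: "K u x = r x" if u: "u \<in> carrier G" and w: "w \<in> W" and eq: "K u w = r w" and x: "x \<in> W" for u w x
  proof -
    obtain n where "x = (r ^^ n) w" using cyclic_on_obtain_funpow[OF cyc w x] .
    then show ?thesis using Kn[OF u w, of n] eq by (simp add: funpow_swap1)
  qed
  have F1: "F \<one>\<^bsub>G\<^esub> = \<one>\<^bsub>G\<^esub>" and K1: "K \<one>\<^bsub>G\<^esub> w0 = r w0" using A[of "\<one>\<^bsub>G\<^esub>" w0] w0 \<phi>0 by auto
  define good where "good u \<longleftrightarrow> (\<forall>x\<in>W. K u x = r x)" for u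
  \<comment> \<open>Compare the images of the arc from \<open>u\<close> to \<open>uw\<close> and of its reverse.\<close>
  have step: "good (u \<otimes>\<^bsub>G\<^esub> w)" if u: "u \<in> carrier G" "good u" and w: "w \<in> W" for u w
  proof -
    let ?v = "u \<otimes>\<^bsub>G\<^esub> w" and ?w = "inv\<^bsub>G\<^esub> w"
    note W = inW[OF w] inW[OF inW(2)[OF w]]
    have v: "?v \<in> carrier G" using u W by simp
    have "F u = F (?v \<otimes>\<^bsub>G\<^esub> ?w)" using u W by (simp add: m_assoc)
    also have "\<dots> = F u \<otimes>\<^bsub>G\<^esub> (r w \<otimes>\<^bsub>G\<^esub> K ?v ?w)"
      using Fm[OF v W(2)] Fm[OF u(1) w] u w W KW[OF v W(2)] inW(1) Fc by (simp add: m_assoc good_def)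
    finally have "r w \<otimes>\<^bsub>G\<^esub> K ?v ?w = \<one>\<^bsub>G\<^esub>"
      using r_cancel_one'[of "F u"] Fc[OF u(1)] W inW(1) KW[OF v W(2)]
      by (metis l_cancel_one' m_closed)
    then have "K ?v ?w = inv\<^bsub>G\<^esub> (r w)"
      using W inW(1) KW[OF v W(2)] by (metis inv_equality inv_inv)
    then have "K ?v ?w = r ?w" using bal w by simp
    then show ?thesis using K_all[OF v W(2)] by (simp add: good_def)
  qed
  \<comment> \<open>Since \<open>W\<close> is closed under inversion, the inverse case of the
    induction over \<open>generate\<close> falls under the case of generators.\<close>
  have genind: "P h"
    if h: "h \<in> carrier G" and 1: "P \<one>\<^bsub>G\<^esub>" and W: "\<And>w. w \<in> W \<Longrightarrow> P w"
      and m: "\<And>g h. g \<in> carrier G \<Longrightarrow> h \<in> carrier G \<Longrightarrow> P g \<Longrightarrow> P h \<Longrightarrow> P (g \<otimes>\<^bsub>G\<^esub> h)" for P h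
    using h unfolding gen[symmetric] by induction (use 1 W m gen inW in auto)
  \<comment> \<open>Induction on the right-hand factor carries \<open>good\<close> from the identity
    to every vertex.\<close>
  have "\<forall>u\<in>carrier G. good u \<longrightarrow> good (u \<otimes>\<^bsub>G\<^esub> h)" if "h \<in> carrier G" for h
    using that by (rule genind) (use step in \<open>auto simp: m_assoc[symmetric]\<close>)
  moreover have "good \<one>\<^bsub>G\<^esub>" using K_all[OF _ w0 K1] by (simp add: good_def)
  ultimately have good: "good u" if "u \<in> carrier G" for u using that by (metis l_one one_closed)
  have FW: "F w = r w" if "w \<in> W" for w
    using Fm[of "\<one>\<^bsub>G\<^esub>" w] that good[of "\<one>\<^bsub>G\<^esub>"] inW F1 by (simp add: good_def)
  \<comment> \<open>Multiplicativity is again an induction on the right-hand factor; for a generator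
    it is \<open>Fm\<close>, because \<open>K u w = r w = F w\<close>.\<close>
  have "\<forall>u\<in>carrier G. F (u \<otimes>\<^bsub>G\<^esub> h) = F u \<otimes>\<^bsub>G\<^esub> F h" if "h \<in> carrier G" for h
    using that
  proof (rule genind)
    fix g h assume "g \<in> carrier G" "h \<in> carrier G"
      "\<forall>u\<in>carrier G. F (u \<otimes>\<^bsub>G\<^esub> g) = F u \<otimes>\<^bsub>G\<^esub> F g" "\<forall>u\<in>carrier G. F (u \<otimes>\<^bsub>G\<^esub> h) = F u \<otimes>\<^bsub>G\<^esub> F h"
    then show "\<forall>u\<in>carrier G. F (u \<otimes>\<^bsub>G\<^esub> (g \<otimes>\<^bsub>G\<^esub> h)) = F u \<otimes>\<^bsub>G\<^esub> F (g \<otimes>\<^bsub>G\<^esub> h)"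
      using Fc by (simp add: m_assoc[symmetric])
  qed (use Fm F1 FW good Fc in \<open>auto simp: good_def\<close>)
  then have "F \<in> hom G G" using Fc by (auto simp: hom_def)
  then have "F \<in> iso G G" using \<phi>1(1) \<phi>2(1) by (auto simp: iso_def bij_betw_def)
  then show thesis using that FW by (simp add: G_def W_def r_def)
qed

text \<open>All Cayley map axioms are carried over to \<open>N\<close> along
  \<open>\<alpha>\<close>, and arcs are mapped by \<open>\<alpha>\<close> in both components. The
  hypothesis \<open>rot_id\<close> is there because \<open>permutes\<close> demands that points
  outside the generators stay fixed.\<close>

lemma cm_isomorphic_if_group_iso:
  assumes M: "cayley_map M" and N: "group (cm_group N)"
    and \<alpha>: "\<alpha> \<in> iso (cm_group M) (cm_group N)"
    and gens: "cm_gens N = \<alpha> ` cm_gens M"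
    and rot: "\<And>w. w \<in> cm_gens M \<Longrightarrow> cm_rot N (\<alpha> w) = \<alpha> (cm_rot M w)"
    and rot_id: "\<And>x. x \<notin> cm_gens N \<Longrightarrow> cm_rot N x = x"
  shows "cm_isomorphic M N"
proof -
  define G H V W where "G = cm_group M" "H = cm_group N" "V = cm_gens M" "W = cm_gens N"
  note defs = this
  interpret G: group G using M by (simp add: cayley_map_def defs)
  interpret H: group H using N by (simp add: defs)
  interpret group_hom G H \<alpha>
    by unfold_locales (use \<alpha> in \<open>auto simp: defs iso_def\<close>)
  have fin: "finite (carrier G)" and sub: "V \<subseteq> carrier G" and gen: "generate G V = carrier G"
    and one: "\<one>\<^bsub>G\<^esub> \<notin> V" and inv: "m_inv G ` V = V"
    and perm: "cm_rot M permutes V" and cyc: "cyclic_on (cm_rot M) V"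
    using M by (auto simp: cayley_map_def defs)
  have inj: "inj_on \<alpha> (carrier G)" and surj: "\<alpha> ` carrier G = carrier H"
    using \<alpha> by (auto simp: iso_def bij_betw_def defs)
  have W: "W = \<alpha> ` V" using gens by (simp add: defs)
  have finV: "finite V" using fin sub finite_subset by blast
  \<comment> \<open>On the finite set \<open>W\<close>, surjectivity suffices for
    bijectivity.\<close>
  have rotW: "cm_rot N ` W = W"
    unfolding W image_image using rot perm by (simp add: defs permutes_image flip: image_image)
  then have "bij_betw (cm_rot N) W W"
    using finV by (simp add: bij_betw_def W eq_card_imp_inj_on)
  then have "cm_rot N permutes W" by (rule bij_imp_permutes) (use rot_id in \<open>simp add: defs\<close>)
  moreover have "cyclic_on (cm_rot N) W"
    unfolding W using cyc by (rule cyclic_on_image) (use rot in \<open>simp add: defs\<close>)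
  moreover have "generate H W = carrier H"
    using generate_img[OF sub] gen surj W by simp
  moreover have "\<one>\<^bsub>H\<^esub> \<notin> W"
    using one inj sub unfolding W by (metis G.one_closed hom_one image_iff inj_on_eq_iff subsetD)
  moreover have "m_inv H ` W = W"
  proof -
    have "m_inv H ` W = \<alpha> ` m_inv G ` V" unfolding W image_image using sub by (intro image_cong) auto
    then show ?thesis by (simp add: inv W)
  qed
  moreover have "finite (carrier H)" "W \<subseteq> carrier H"
    using fin sub W by (auto simp flip: surj)
  ultimately have cN: "cayley_map N" using N by (simp add: cayley_map_def defs)
  \<comment> \<open>\<open>app_iso\<close> takes head and tail from the record, so they have to be
    the functions of the target graph.\<close>
  define \<phi> where "\<phi> = \<lparr>iso_verts = \<alpha>, iso_arcs = map_prod \<alpha> \<alpha>,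
    iso_head = (\<lambda>(\<eta>, \<omega>). \<eta> \<otimes>\<^bsub>H\<^esub> \<omega>), iso_tail = fst\<rparr>"
  have "wf_digraph (cm_graph M)"
    using graph_cm_graph[OF M] by (simp add: graph_def digraph_def fin_digraph_def)
  moreover have "inj_on (map_prod \<alpha> \<alpha>) (carrier G \<times> V)"
    using inj sub by (auto simp: inj_on_def)
  ultimately have "pre_digraph.digraph_isomorphism (cm_graph M) \<phi>"
    using inj sub
    by (auto simp: pre_digraph.digraph_isomorphism_def \<phi>_def cayley_graph_def defs[symmetric])
  moreover have "app_iso \<phi> (cm_graph M) = cm_graph N"
    by (simp add: app_iso_def \<phi>_def cayley_graph_def defs[symmetric] surj W map_prod_surj_on)
  moreover have "\<forall>a\<in>arcs (cm_graph M). iso_arcs \<phi> (arc_rot M a) = arc_rot N (iso_arcs \<phi> a)"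
    using rot by (auto simp: \<phi>_def arc_rot_def cayley_graph_def)
  ultimately have "cm_isomorphism M N \<phi>" by (simp add: cm_isomorphism_def)
  then show ?thesis using M cN by (auto simp: cm_isomorphic_def)
qed

lemma type_I_square_neq_one:
  assumes M: "cayley_map (CM G \<Omega> \<rho>)" "type_I (CM G \<Omega> \<rho>)" and w: "w \<in> \<Omega>"
  shows "w [^]\<^bsub>G\<^esub> (2::nat) \<noteq> \<one>\<^bsub>G\<^esub>"
proof
  interpret group G using M by (simp add: cayley_map_def CM_def)
  have sub: "\<Omega> \<subseteq> carrier G" and one: "\<one>\<^bsub>G\<^esub> \<notin> \<Omega>" using M by (simp_all add: cayley_map_def CM_def)
  assume "w [^]\<^bsub>G\<^esub> (2::nat) = \<one>\<^bsub>G\<^esub>"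
  then have "ord w dvd 2" using w sub pow_eq_id by blast
  moreover have "ord w \<noteq> 1" using w sub one ord_eq_1 by blast
  moreover have "ord w \<noteq> 2" using M(2) w by (simp add: type_I_def CM_def)
  ultimately show False using dvd_imp_le[of "ord w" 2] by (cases "ord w = 0") auto
qed

text \<open>If the inverse of \<open>w\<close> is \<open>(\<rho> ^^ k) w\<close>, balance shows that
  a second application of \<open>\<rho> ^^ k\<close> returns to \<open>w\<close>; so
  \<open>2 * n\<close> divides \<open>2 * k\<close> and \<open>k = n * m\<close>. For even
  \<open>m\<close> the element \<open>w\<close> would be its own inverse, against type I; for odd
  \<open>m\<close> the powers \<open>k\<close> and \<open>n\<close> agree at
  \<open>w\<close>.\<close>

lemma balanced_funpow_inv:
  assumes M: "cayley_map (CM G \<Omega> \<rho>)" "balanced (CM G \<Omega> \<rho>)" "type_I (CM G \<Omega> \<rho>)"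
    and card: "card \<Omega> = 2 * n" and w: "w \<in> \<Omega>"
  shows "(\<rho> ^^ n) w = inv\<^bsub>G\<^esub> w"
proof -
  interpret group G using M by (simp add: cayley_map_def CM_def)
  have sub: "\<Omega> \<subseteq> carrier G" and cyc: "cyclic_on \<rho> \<Omega>"
    and inv: "m_inv G ` \<Omega> = \<Omega>"
    using M by (simp_all add: cayley_map_def CM_def)
  have inv_w: "inv\<^bsub>G\<^esub> w \<in> \<Omega>" using inv w by blast
  then obtain k where k: "inv\<^bsub>G\<^esub> w = (\<rho> ^^ k) w"
    using cyclic_on_obtain_funpow[OF cyc w] by blast
  have "(\<rho> ^^ j) (inv\<^bsub>G\<^esub> w) = inv\<^bsub>G\<^esub> ((\<rho> ^^ j) w)" for j
    using M(2) cyclic_on_funpow_in[OF cyc w] by (induction j) (simp_all add: balanced_def CM_def)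
  then have "(\<rho> ^^ k) ((\<rho> ^^ k) w) = w" using k w sub by (metis inv_inv subsetD)
  then have "(\<rho> ^^ (k + k)) w = w" by (simp add: funpow_add)
  then have "2 * n dvd 2 * k" using cyclic_on_funpow_eq_iff[OF cyc w] card by (simp add: mult_2)
  then obtain m where m: "k = n * m" by (auto simp: dvd_def)
  have period: "(\<rho> ^^ (2 * n * j)) w = w" for j using cyclic_on_funpow_eq_iff[OF cyc w] card by simp
  have "odd m"
  proof
    assume "even m"
    then obtain j where "m = 2 * j" ..
    then have "inv\<^bsub>G\<^esub> w = w" using k m period[of j] by (simp add: ac_simps)
    then have "w \<otimes>\<^bsub>G\<^esub> w = \<one>\<^bsub>G\<^esub>" using w sub by (metis r_inv subsetD)
    then have "w [^]\<^bsub>G\<^esub> (2::nat) = \<one>\<^bsub>G\<^esub>" using w sub by (simp add: numeral_2_eq_2 subsetD)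
    then show False using type_I_square_neq_one[OF M(1,3) w] by contradiction
  qed
  then obtain j where "m = 2 * j + 1" by (elim oddE)
  then have "k = n + 2 * n * j" by (simp add: m algebra_simps)
  then have "(\<rho> ^^ k) w = (\<rho> ^^ n) w" using period[of j] by (simp add: funpow_add)
  then show ?thesis using k by simp
qed

text \<open>The elements on which two homomorphisms agree form a subgroup.\<close>

lemma group_hom_eq_on_generators:
  assumes "group_hom G H f" "group_hom G H g" "generate G S = carrier G"
    and eq: "\<And>s. s \<in> S \<Longrightarrow> f s = g s" and "x \<in> carrier G"
  shows "f x = g x"
proof -
  interpret f: group_hom G H f by fact
  interpret g: group_hom G H g by fact
  have S: "S \<subseteq> carrier G" using assms(3) generate.incl by fastforce
  have "subgroup {x \<in> carrier G. f x = g x} G"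
    by (rule f.G.subgroupI) auto
  then have "generate G S \<subseteq> {x \<in> carrier G. f x = g x}"
    using S eq by (intro f.G.generate_subgroup_incl) auto
  then show ?thesis using assms(3,5) by auto
qed

section \<open>Computations with permutations of five points\<close>

text \<open>
  \<open>Word a b c d e\<close> is the one-line notation of a permutation of five points, and products are taken
  from left to right as in \<^const>\<open>S5\<close>. These types keep the evaluation of the finite checks by
  \<open>code_simp\<close> fast. The checks use \<open>\<not> P \<or> Q\<close> instead of \<open>P \<longrightarrow> Q\<close> because \<open>code_simp\<close> evaluates disjunction
  lazily but not implication, and \<open>let\<close> so that the lists are computed only once.
\<close>

datatype point = A | B | C | D | E

datatype word = Word point point point point point

fun word_at :: "word \<Rightarrow> point \<Rightarrow> point" where
  "word_at (Word a b c d e) A = a"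
| "word_at (Word a b c d e) B = b"
| "word_at (Word a b c d e) C = c"
| "word_at (Word a b c d e) D = d"
| "word_at (Word a b c d e) E = e"

fun word_mult :: "word \<Rightarrow> word \<Rightarrow> word" where
  "word_mult (Word a b c d e) w =
     Word (word_at w a) (word_at w b) (word_at w c) (word_at w d) (word_at w e)"

definition word_id :: word where
  "word_id = Word A B C D E"

fun word_of_list :: "point list \<Rightarrow> word" where
  "word_of_list [a, b, c, d, e] = Word a b c d e"
| "word_of_list _ = word_id"

primrec word_pow :: "word \<Rightarrow> nat \<Rightarrow> word" where
  "word_pow w 0 = word_id"
| "word_pow w (Suc n) = word_mult (word_pow w n) w"

definition words :: "word list" where
  "words = map word_of_list (permutations_of_set_list [A, B, C, D, E])"

definition words_of_order_3 :: "word list" where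
  "words_of_order_3 = filter (\<lambda>w. w \<noteq> word_id \<and> word_pow w 3 = word_id) words"

text \<open>
  The even permutations of five points are the identity, the 3-cycles, the 5-cycles and the products
  of two disjoint transpositions; the last are the involutions with exactly one fixed point.
\<close>

definition alternating :: "word \<Rightarrow> bool" where
  "alternating w \<longleftrightarrow> word_pow w 3 = word_id \<or> word_pow w 5 = word_id \<or>
     word_pow w 2 = word_id \<and> length (filter (\<lambda>x. word_at w x = x) [A, B, C, D, E]) = 1"

definition word_involution :: "word \<Rightarrow> bool" where
  "word_involution w \<longleftrightarrow> w \<noteq> word_id \<and> word_pow w 2 = word_id"

text \<open>Element orders in \<open>S5\<close> are at most 6, and each number from 1 to 6 divides
  4, 5 or 6. This is what bounds the valency.\<close>

lemma words_exponents:
  "list_all (\<lambda>w. word_pow w 4 = word_id \<or> word_pow w 5 = word_id \<or> word_pow w 6 = word_id) words"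
  by code_simp

text \<open>Induction step for \<open>alternating_word_of\<close>: since 3-cycles generate
  \<open>A5\<close>, closure under right factors of order 3 reaches every even permutation.\<close>

lemma alternating_closed:
  "let ws = words; ts = words_of_order_3 in
   list_all (\<lambda>w. \<not> alternating w \<or> list_all (\<lambda>t. alternating (word_mult w t)) ts) ws"
  by code_simp

text \<open>The 3-cycles (123), (124) and (125).\<close>

definition std_generators :: "word list" where
  "std_generators = [Word B C A D E, Word B D C A E, Word B E C D A]"

text \<open>Serves to show that the three standard generators generate \<open>A5\<close>:
  \<open>vs\<close> holds the products of two entries of \<open>us\<close>, so five factors are
  available, and the identity in \<open>us\<close> admits shorter products.\<close>

lemma words_of_order_3_products:
  "let us = word_id # std_generators; vs = concat (map (\<lambda>a. map (word_mult a) us) us) in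
   list_all (\<lambda>t. list_ex (\<lambda>a. list_ex (\<lambda>b. list_ex (\<lambda>c. t = word_mult (word_mult a b) c) us) vs) vs)
     words_of_order_3"
  by code_simp

text \<open>The combinatorial core of the description of automorphisms. Equations of the form
  \<open>a s = s x\<close> express conjugacy without inverses, and testing the product of
  \<open>a\<close> and \<open>b\<close> first discards most pairs before any \<open>c\<close> is
  tried.\<close>

lemma order_3_triples:
  "let ws = words; ts = words_of_order_3 in
   list_all (\<lambda>a. list_all (\<lambda>b. \<not> word_involution (word_mult a b) \<or>
     list_all (\<lambda>c. \<not> word_involution (word_mult a c) \<or> \<not> word_involution (word_mult b c) \<or>
       list_ex (\<lambda>s. word_mult a s = word_mult s (Word B C A D E) \<and>
         word_mult b s = word_mult s (Word B D C A E) \<and>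
         word_mult c s = word_mult s (Word B E C D A)) ws) ts) ts) ts"
  by code_simp

text \<open>
  \<open>w (s\<^sup>2 w) = s\<^sup>2\<close> says that \<open>s\<^sup>2\<close> inverts \<open>w\<close>, and \<open>c = s w s\<^sup>3\<close> is the conjugate of \<open>w\<close> by \<open>s\<close>. If \<open>w\<close> is a
  5-cycle, \<open>s\<close> normalizes the group generated by \<open>w\<close>, so this case is excluded by \<open>c w \<noteq> w c\<close>.
\<close>

lemma order_4_pairs:
  "let ws = words; es = filter (\<lambda>w. alternating w \<and> word_pow w 2 \<noteq> word_id) ws in
   list_all (\<lambda>s. word_pow s 4 \<noteq> word_id \<or> word_pow s 2 = word_id \<or>
     (let s2 = word_pow s 2; s3 = word_pow s 3 in
     list_all (\<lambda>w. word_mult w (word_mult s2 w) \<noteq> s2 \<or>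
         (let c = word_mult (word_mult s w) s3 in word_mult c w = word_mult w c) \<or>
       list_ex (\<lambda>t. word_mult t s = word_mult (Word D E C B A) t \<and>
                    word_mult t w = word_mult (Word B C A D E) t) ws) es)) ws"
  by code_simp

text \<open>Here \<open>s\<close> has order 6, so \<open>s\<^sup>3\<close> is a transposition. The
  even non-involutions that it inverts are the six 3-cycles moving both of its points, and
  conjugation by \<open>s\<close> permutes these transitively.\<close>

lemma order_6_pairs:
  "let ws = words; es = filter (\<lambda>w. alternating w \<and> word_pow w 2 \<noteq> word_id) ws in
   list_all (\<lambda>s. word_pow s 6 \<noteq> word_id \<or> word_pow s 2 = word_id \<or>
     (let s3 = word_pow s 3 in s3 = word_id \<or>
     list_all (\<lambda>w. word_mult w (word_mult s3 w) \<noteq> s3 \<or>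
       list_ex (\<lambda>t. word_mult t s = word_mult (Word B A D E C) t \<and>
                    word_mult t w = word_mult (Word B C A D E) t) ws) es)) ws"
  by code_simp

text \<open>This gives triviality of the centralizer of \<open>A5\<close> in \<open>S5\<close>,
  tested on generators.\<close>

lemma centralizer_of_generators:
  "let us = [Word B C A D E, Word B D C A E, Word B E C D A] in
   list_all (\<lambda>w. w = word_id \<or> list_ex (\<lambda>u. word_mult w u \<noteq> word_mult u w) us) words"
  by code_simp

text \<open>Each product consists of two disjoint transpositions, as in (123)(124) = (14)(23).
  Automorphisms preserve this property, which brings \<open>order_3_triples\<close> into
  play.\<close>

lemma involution_products:
  "let x = Word B C A D E; y = Word B D C A E; z = Word B E C D A in
   word_involution (word_mult x y) \<and> word_involution (word_mult x z) \<and> word_involution (word_mult y z)"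
  by code_simp

lemma length_words: "length words = 120"
  by code_simp

section \<open>The group \<open>A\<^sub>5\<close> and its automorphisms\<close>

text \<open>The final default stands for 5; the map is injective only on
  \<open>{1..5}\<close>.\<close>

definition point_of :: "nat \<Rightarrow> point" where
  "point_of i = (if i = 1 then A else if i = 2 then B else if i = 3 then C else if i = 4 then D else E)"

definition word_of :: "(nat \<Rightarrow> nat) \<Rightarrow> word" where
  "word_of p = Word (point_of (p 1)) (point_of (p 2)) (point_of (p 3)) (point_of (p 4)) (point_of (p 5))"

lemma atLeastAtMost_1_5: "{1..5} = {1, 2, 3, 4, 5::nat}"
  by auto

lemma in_1_5_cases: "i \<in> {1..5} \<longleftrightarrow> i = 1 \<or> i = 2 \<or> i = 3 \<or> i = 4 \<or> i = (5::nat)"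
  by auto

lemma inj_on_point_of: "inj_on point_of {1..5}"
  by (auto simp: inj_on_def point_of_def atLeastAtMost_1_5)

section \<open>The groups \<open>S5\<close> and \<open>A5\<close> with left-to-right
  multiplication\<close>

lemma carrier_S5: "carrier S5 = {p. p permutes {1..5}}"
  by (simp add: S5_def sym_group_def)

lemma one_S5: "\<one>\<^bsub>S5\<^esub> = id"
  by (simp add: S5_def sym_group_def)

lemma mult_S5: "p \<otimes>\<^bsub>S5\<^esub> q = q \<circ> p"
  by (simp add: S5_def)

lemma carrier_A5: "carrier A5 = {p. p permutes {1..5} \<and> evenperm p}"
  by (simp add: A5_def alt_group_def)

lemma A5_eq: "A5 = S5\<lparr>carrier := carrier A5\<rparr>"
  by (simp add: A5_def alt_group_def S5_def)

lemma one_A5: "\<one>\<^bsub>A5\<^esub> = \<one>\<^bsub>S5\<^esub>" and mult_A5: "p \<otimes>\<^bsub>A5\<^esub> q = p \<otimes>\<^bsub>S5\<^esub> q"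
  by (simp_all add: A5_def alt_group_def S5_def)

lemma group_S5: "group S5"
proof (rule groupI)
  fix p assume "p \<in> carrier S5"
  then show "\<exists>q\<in>carrier S5. q \<otimes>\<^bsub>S5\<^esub> p = \<one>\<^bsub>S5\<^esub>"
    by (intro bexI[of _ "inv' p"]) (auto simp: carrier_S5 mult_S5 one_S5 permutes_inv permutes_inv_o)
qed (auto simp: carrier_S5 mult_S5 one_S5 permutes_compose permutes_id comp_assoc)

interpretation S5: group S5
  by (rule group_S5)

lemma permutation_S5: "p \<in> carrier S5 \<Longrightarrow> permutation p"
  using permutation_permutes by (auto simp: carrier_S5)

lemma inv_S5: "p \<in> carrier S5 \<Longrightarrow> inv\<^bsub>S5\<^esub> p = inv' p"
  by (intro S5.inv_equality) (auto simp: carrier_S5 mult_S5 one_S5 permutes_inv permutes_inv_o)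

lemma subgroup_A5: "subgroup (carrier A5) S5"
proof (rule S5.subgroupI)
  have "id \<in> carrier A5" by (simp add: carrier_A5 permutes_id)
  then show "carrier A5 \<noteq> {}" by blast
next
  fix p q assume "p \<in> carrier A5" "q \<in> carrier A5"
  then show "p \<otimes>\<^bsub>S5\<^esub> q \<in> carrier A5"
    using permutation_S5 by (auto simp: carrier_A5 carrier_S5 mult_S5 permutes_compose evenperm_comp)
next
  fix p assume p: "p \<in> carrier A5"
  then have "p \<in> carrier S5" by (simp add: carrier_A5 carrier_S5)
  then show "inv\<^bsub>S5\<^esub> p \<in> carrier A5"
    using p by (simp add: inv_S5 carrier_A5 permutes_inv evenperm_inv permutation_S5)
qed (auto simp: carrier_A5 carrier_S5)

lemma A5_subset_S5: "x \<in> carrier A5 \<Longrightarrow> x \<in> carrier S5"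
  by (simp add: carrier_A5 carrier_S5)

lemma group_A5: "group A5"
  using S5.subgroup_imp_group[OF subgroup_A5] A5_eq by simp

interpretation A5: group A5
  by (rule group_A5)

lemma inv_A5: "x \<in> carrier A5 \<Longrightarrow> inv\<^bsub>A5\<^esub> x = inv\<^bsub>S5\<^esub> x"
  using S5.m_inv_consistent[OF subgroup_A5] A5_eq by metis

lemma pow_A5: "x [^]\<^bsub>A5\<^esub> (n::nat) = x [^]\<^bsub>S5\<^esub> n"
  using S5.nat_pow_consistent[of x n "carrier A5"] A5_eq by simp

section \<open>Faithful translation of permutations into words\<close>

lemma word_of_mult:
  assumes "p \<in> carrier S5"
  shows "word_of (p \<otimes>\<^bsub>S5\<^esub> q) = word_mult (word_of p) (word_of q)"
proof -
  have "word_at (word_of q) (point_of i) = point_of (q i)" if "i \<in> {1..5}" for i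
    using that unfolding in_1_5_cases by (auto simp: point_of_def word_of_def)
  moreover have "p i \<in> {1..5}" if "i \<in> {1..5}" for i
    using assms that permutes_in_image[of p "{1..5}"] by (auto simp: carrier_S5)
  ultimately show ?thesis by (simp add: word_of_def mult_S5)
qed

lemma word_of_one: "word_of \<one>\<^bsub>S5\<^esub> = word_id"
  by (simp add: word_of_def word_id_def one_S5 point_of_def)

lemma word_of_pow: "p \<in> carrier S5 \<Longrightarrow> word_of (p [^]\<^bsub>S5\<^esub> (n::nat)) = word_pow (word_of p) n"
  by (induction n) (simp_all add: word_of_one word_of_mult)

lemma inj_on_word_of: "inj_on word_of (carrier S5)"
proof (rule inj_onI)
  fix p q assume pq: "p \<in> carrier S5" "q \<in> carrier S5" and eq: "word_of p = word_of q"
  have "p i = q i" if "i \<in> {1..5}" for i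
  proof -
    have "point_of (p i) = point_of (q i)"
      using eq that unfolding in_1_5_cases by (auto simp: word_of_def)
    moreover have "p i \<in> {1..5}" "q i \<in> {1..5}"
      using pq that permutes_in_image[of p "{1..5}"] permutes_in_image[of q "{1..5}"]
      by (auto simp: carrier_S5)
    ultimately show ?thesis using inj_on_point_of by (auto dest: inj_onD)
  qed
  moreover have "p i = q i" if "i \<notin> {1..5}" for i
    using pq that by (auto simp: carrier_S5 permutes_def)
  ultimately show "p = q" by (intro ext) blast
qed

lemma word_of_eq_iff: "p \<in> carrier S5 \<Longrightarrow> q \<in> carrier S5 \<Longrightarrow> word_of p = word_of q \<longleftrightarrow> p = q"
  using inj_on_word_of by (auto simp: inj_on_def)

lemma word_pow_eq_id_iff:
  "s \<in> carrier S5 \<Longrightarrow> word_pow (word_of s) k = word_id \<longleftrightarrow> s [^]\<^bsub>S5\<^esub> k = \<one>\<^bsub>S5\<^esub>"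
  by (simp add: word_of_eq_iff flip: word_of_pow word_of_one)

text \<open>By counting: injectivity gives 120 images, all of them listed, and the list has length
  120. Thus a word found by a check over \<open>words\<close> comes from an actual
  permutation.\<close>

lemma word_of_image: "word_of ` carrier S5 = set words"
proof (rule card_seteq)
  show "word_of ` carrier S5 \<subseteq> set words"
  proof
    fix w assume "w \<in> word_of ` carrier S5"
    then obtain p where p: "p permutes {1..5}" and w: "w = word_of p" by (auto simp: carrier_S5)
    let ?l = "map (point_of \<circ> p) [1, 2, 3, 4, 5]"
    have "set ?l = point_of ` p ` {1, 2, 3, 4, 5}" by auto
    also have "\<dots> = set [A, B, C, D, E]"
      unfolding permutes_image[OF p, unfolded atLeastAtMost_1_5] by (auto simp: point_of_def)
    finally have s: "set ?l = set [A, B, C, D, E]" .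
    \<comment> \<open>The list has length five and its set has five elements.\<close>
    have "distinct ?l" by (rule card_distinct, subst s) simp
    then have "?l \<in> permutations_of_set (set [A, B, C, D, E])"
      using s unfolding permutations_of_set_def by blast
    then have "?l \<in> set (permutations_of_set_list [A, B, C, D, E])"
      unfolding permutations_of_list by simp
    then have "word_of_list ?l \<in> set words" unfolding words_def set_map by (rule imageI)
    then show "w \<in> set words" by (simp add: w word_of_def)
  qed
  have "carrier S5 = carrier (sym_group 5)" by (simp add: S5_def)
  then have "card (word_of ` carrier S5) = 120"
    using card_image[OF inj_on_word_of] by (simp add: sym_group_card_carrier fact_numeral)
  then show "card (set words) \<le> card (word_of ` carrier S5)"
    using card_length[of words] by (simp add: length_words)
qed simp

lemma word_of_in_words: "p \<in> carrier S5 \<Longrightarrow> word_of p \<in> set words"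
  using word_of_image by blast

lemma word_of_in_words_of_order_3:
  assumes "p \<in> carrier S5"
  shows "word_of p \<in> set words_of_order_3 \<longleftrightarrow> p \<noteq> \<one>\<^bsub>S5\<^esub> \<and> p [^]\<^bsub>S5\<^esub> (3::nat) = \<one>\<^bsub>S5\<^esub>"
  using assms word_of_in_words
  by (simp add: words_of_order_3_def word_of_eq_iff flip: word_of_pow word_of_one)

lemma word_involution_word_of:
  assumes "p \<in> carrier S5"
  shows "word_involution (word_of p) \<longleftrightarrow> p \<noteq> \<one>\<^bsub>S5\<^esub> \<and> p [^]\<^bsub>S5\<^esub> (2::nat) = \<one>\<^bsub>S5\<^esub>"
  using assms by (simp add: word_involution_def word_of_eq_iff flip: word_of_pow word_of_one)

section \<open>Generation of \<open>A5\<close> by 3-cycles and a test for even permutations\<close>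

lemma generate_three_cycles: "generate A5 (three_cycles 5) = carrier A5"
proof
  show "generate A5 (three_cycles 5) \<subseteq> carrier A5"
    using three_cycles_incl[of 5] by (intro A5.generate_incl) (simp add: A5_def)
  have "x \<in> generate A5 (three_cycles 5)" if "x \<in> generate (alt_group 5) (three_cycles 5)" for x
    using that
  proof induction
    case one
    then show ?case using generate.one[of A5] by (simp add: A5_def)
  next
    case (incl h)
    then show ?case by (rule generate.incl)
  next
    case (inv h)
    then have h: "h \<in> carrier A5" "h \<in> carrier (alt_group 5)"
      using three_cycles_incl[of 5] by (auto simp: A5_def)
    then have "inv\<^bsub>alt_group 5\<^esub> h = inv\<^bsub>A5\<^esub> h"
      by (simp add: alt_group_inv_equality inv_A5 inv_S5 A5_subset_S5)
    then show ?case using generate.inv[OF inv, of A5] by simp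
  next
    case (eng g h)
    \<comment> \<open>The two multiplications are opposite, so the factors change places.\<close>
    have "g \<otimes>\<^bsub>alt_group 5\<^esub> h = h \<otimes>\<^bsub>A5\<^esub> g" by (simp add: mult_A5 mult_S5 alt_group_mult)
    then show ?case using generate.eng[OF eng(4,3)] by (simp only:)
  qed
  then show "carrier A5 \<subseteq> generate A5 (three_cycles 5)"
    using alt_group_carrier_as_three_cycles[of 5] by (auto simp: A5_def)
qed

lemma three_cycles_order_3:
  assumes "t \<in> three_cycles 5"
  shows "t \<in> carrier A5" "t \<noteq> \<one>\<^bsub>S5\<^esub>" "t [^]\<^bsub>S5\<^esub> (3::nat) = \<one>\<^bsub>S5\<^esub>"
proof -
  obtain cs where cs: "t = cycle_of_list cs" "distinct cs" "length cs = 3" using assms by auto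
  then obtain a b c where t: "t = cycle_of_list [a, b, c]" and d: "distinct [a, b, c]"
    by (auto simp: length_Suc_conv numeral_3_eq_3)
  show "t \<in> carrier A5" using assms three_cycles_incl[of 5] by (auto simp: A5_def)
  have "t a = b" using t d by (simp add: transpose_def)
  then show "t \<noteq> \<one>\<^bsub>S5\<^esub>" using d by (auto simp: one_S5)
  show "t [^]\<^bsub>S5\<^esub> (3::nat) = \<one>\<^bsub>S5\<^esub>"
    using d unfolding t by (auto simp: numeral_3_eq_3 mult_S5 one_S5 transpose_def fun_eq_iff)
qed

lemma inv_order_3:
  assumes "t \<in> carrier S5" "t \<noteq> \<one>\<^bsub>S5\<^esub>" "t [^]\<^bsub>S5\<^esub> (3::nat) = \<one>\<^bsub>S5\<^esub>"
  shows "inv\<^bsub>S5\<^esub> t \<noteq> \<one>\<^bsub>S5\<^esub>" "(inv\<^bsub>S5\<^esub> t) [^]\<^bsub>S5\<^esub> (3::nat) = \<one>\<^bsub>S5\<^esub>"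
  using assms by (simp_all add: S5.nat_pow_inv)

lemma alternating_word_of:
  assumes "x \<in> carrier A5"
  shows "alternating (word_of x)"
proof -
  have closed: "alternating (word_of (u \<otimes>\<^bsub>S5\<^esub> t))"
    if "u \<in> carrier S5" "alternating (word_of u)" "t \<in> carrier S5" "t \<noteq> \<one>\<^bsub>S5\<^esub>"
      "t [^]\<^bsub>S5\<^esub> (3::nat) = \<one>\<^bsub>S5\<^esub>" for u t
    using alternating_closed that word_of_in_words
    by (simp add: Let_def list_all_iff word_of_mult) (metis word_of_in_words_of_order_3)
  \<comment> \<open>The claim is strengthened to right multiplication of an arbitrary
    \<open>u\<close>, because \<open>closed\<close> only handles right factors of order 3; the
    identity as \<open>u\<close> recovers the statement.\<close>
  have "\<forall>u\<in>carrier S5. alternating (word_of u) \<longrightarrow> alternating (word_of (u \<otimes>\<^bsub>S5\<^esub> x))"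
    using assms unfolding generate_three_cycles[symmetric]
  proof induction
    case one
    then show ?case by (simp add: one_A5)
  next
    case (incl t)
    then show ?case using three_cycles_order_3[OF incl] closed by (simp add: A5_subset_S5)
  next
    case (inv t)
    note t = three_cycles_order_3[OF inv]
    then show ?case using inv_order_3[of t] closed by (simp add: inv_A5 A5_subset_S5)
  next
    case (eng g h)
    note gh = eng(1,2)[unfolded generate_three_cycles, THEN A5_subset_S5]
    with eng(3,4) show ?case by (auto simp: mult_A5 S5.m_assoc[symmetric])
  qed
  moreover have "alternating (word_of \<one>\<^bsub>S5\<^esub>)"
    by (simp add: word_of_one alternating_def word_id_def numeral_3_eq_3)
  ultimately show ?thesis using assms by (metis S5.l_one S5.one_closed A5_subset_S5)
qed

declare word_mult.simps [simp del]

section \<open>Three standard generators of \<open>A5\<close>\<close>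

definition x3 :: "nat \<Rightarrow> nat" where "x3 = cycle_of_list [1, 2, 3]"
definition x4 :: "nat \<Rightarrow> nat" where "x4 = cycle_of_list [1, 2, 4]"
definition x5 :: "nat \<Rightarrow> nat" where "x5 = cycle_of_list [1, 2, 5]"

lemma std_generators_three_cycles: "{x3, x4, x5} \<subseteq> three_cycles 5"
proof -
  have "cycle_of_list [1, 2, k] \<in> three_cycles 5" if "k \<in> {3, 4, 5}" for k
    using that by (intro CollectI exI[of _ "[1, 2, k]"]) auto
  then show ?thesis by (simp add: x3_def x4_def x5_def)
qed

lemma std_in_A5 [simp]: "x3 \<in> carrier A5" "x4 \<in> carrier A5" "x5 \<in> carrier A5"
  using std_generators_three_cycles three_cycles_order_3(1) by auto

lemma std_in_S5 [simp]: "x3 \<in> carrier S5" "x4 \<in> carrier S5" "x5 \<in> carrier S5"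
  by (simp_all add: A5_subset_S5)

lemma word_of_std [simp]:
  "word_of x3 = Word B C A D E" "word_of x4 = Word B D C A E" "word_of x5 = Word B E C D A"
  by (simp_all add: x3_def x4_def x5_def word_of_def point_of_def transpose_def)

lemma generate_std: "generate A5 {x3, x4, x5} = carrier A5"
proof
  let ?H = "generate A5 {x3, x4, x5}"
  show sub: "?H \<subseteq> carrier A5" by (rule A5.generate_incl) simp
  \<comment> \<open>The evaluated factorizations of 3-cycles live among words, so they are applied
    inside the image \<open>Q\<close> of the subgroup; injectivity of \<open>word_of\<close> then
    leads back to \<open>?H\<close>.\<close>
  define Q where "Q = word_of ` ?H"
  have mult: "word_mult v w \<in> Q" if v: "v \<in> Q" and w: "w \<in> Q" for v w
  proof -
    obtain g h where gh: "g \<in> ?H" "h \<in> ?H" "v = word_of g" "w = word_of h"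
      using v w unfolding Q_def by blast
    then have "word_mult v w = word_of (g \<otimes>\<^bsub>A5\<^esub> h)"
      using sub A5_subset_S5 by (simp add: mult_A5 word_of_mult subset_iff)
    then show ?thesis using generate.eng[OF gh(1,2)] by (simp add: Q_def)
  qed
  have "word_id \<in> Q"
    unfolding Q_def word_of_one[symmetric] one_A5[symmetric] by (intro imageI generate.one)
  moreover have "word_of y \<in> Q" if "y \<in> {x3, x4, x5}" for y
    unfolding Q_def using that by (intro imageI generate.incl)
  ultimately have us: "set (word_id # std_generators) \<subseteq> Q"
    by (simp add: std_generators_def flip: word_of_std)
  have "three_cycles 5 \<subseteq> ?H"
  proof
    fix t assume "t \<in> three_cycles 5"
    note t = three_cycles_order_3[OF this]
    then have "word_of t \<in> set words_of_order_3"
      by (simp add: word_of_in_words_of_order_3 A5_subset_S5)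
    then obtain a b c where abc: "word_of t = word_mult (word_mult a b) c"
      "a \<in> (\<Union>u\<in>set (word_id # std_generators). word_mult u ` set (word_id # std_generators))"
      "b \<in> (\<Union>u\<in>set (word_id # std_generators). word_mult u ` set (word_id # std_generators))"
      "c \<in> set (word_id # std_generators)"
      using words_of_order_3_products unfolding Let_def list_all_iff list_ex_iff set_concat set_map
        image_image by (metis (no_types, lifting))
    have "a \<in> Q" "b \<in> Q" "c \<in> Q" using abc(2-4) us mult by blast+
    then have "word_of t \<in> Q" unfolding abc(1) by (intro mult)
    then show "t \<in> ?H" unfolding Q_def using t(1) sub A5_subset_S5 word_of_eq_iff by blast
  qed
  then show "carrier A5 \<subseteq> ?H"
    unfolding generate_three_cycles[symmetric]
    by (intro A5.generate_subgroup_incl A5.generate_is_subgroup) simp_all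
qed

section \<open>Conjugation and the automorphisms of \<open>A5\<close>\<close>

lemma conj_S5_closed [simp]: "s \<in> carrier S5 \<Longrightarrow> x \<in> carrier S5 \<Longrightarrow> conj_S5 s x \<in> carrier S5"
  by (simp add: conj_S5_def)

lemma conj_S5_mult:
  "s \<in> carrier S5 \<Longrightarrow> t \<in> carrier S5 \<Longrightarrow> x \<in> carrier S5 \<Longrightarrow>
    conj_S5 (s \<otimes>\<^bsub>S5\<^esub> t) x = conj_S5 s (conj_S5 t x)"
  by (simp add: conj_S5_def S5.m_assoc S5.inv_mult_group)

lemma conj_S5_one [simp]: "x \<in> carrier S5 \<Longrightarrow> conj_S5 \<one>\<^bsub>S5\<^esub> x = x"
  by (simp add: conj_S5_def)

lemma conj_S5_hom:
  assumes "s \<in> carrier S5" "x \<in> carrier S5" "y \<in> carrier S5"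
  shows "conj_S5 s (x \<otimes>\<^bsub>S5\<^esub> y) = conj_S5 s x \<otimes>\<^bsub>S5\<^esub> conj_S5 s y"
proof -
  have "inv\<^bsub>S5\<^esub> s \<otimes>\<^bsub>S5\<^esub> (s \<otimes>\<^bsub>S5\<^esub> z) = z" if "z \<in> carrier S5" for z
    using assms that by (simp flip: S5.m_assoc)
  then show ?thesis using assms by (simp add: conj_S5_def S5.m_assoc)
qed

text \<open>Removes the inverse, so that conjugacy can be tested on words by products alone.\<close>

lemma conj_S5_eq_iff:
  "s \<in> carrier S5 \<Longrightarrow> x \<in> carrier S5 \<Longrightarrow> y \<in> carrier S5 \<Longrightarrow>
    conj_S5 s x = y \<longleftrightarrow> s \<otimes>\<^bsub>S5\<^esub> x = y \<otimes>\<^bsub>S5\<^esub> s"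
  by (simp add: conj_S5_def S5.inv_solve_right')

lemma conj_S5_A5:
  assumes "s \<in> carrier S5" "x \<in> carrier A5"
  shows "conj_S5 s x \<in> carrier A5"
proof -
  have "x \<in> carrier S5" "inv\<^bsub>S5\<^esub> s \<in> carrier S5" using assms by (simp_all add: A5_subset_S5)
  note perm = this[THEN permutation_S5] permutation_S5[OF assms(1)]
  have "conj_S5 s x \<in> carrier S5" using assms by (simp add: A5_subset_S5)
  moreover have "evenperm (conj_S5 s x)"
    using assms perm
    by (simp add: conj_S5_def mult_S5 inv_S5 carrier_A5 evenperm_comp evenperm_inv permutation_compose)
  ultimately show ?thesis by (simp add: carrier_A5 carrier_S5)
qed

lemma conj_S5_iso:
  assumes s: "s \<in> carrier S5"
  shows "conj_S5 s \<in> iso A5 A5"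
proof (rule isoI)
  show "conj_S5 s \<in> hom A5 A5"
    using s by (auto simp: hom_def conj_S5_A5 mult_A5 conj_S5_hom A5_subset_S5)
  show "bij_betw (conj_S5 s) (carrier A5) (carrier A5)"
    by (rule bij_betwI[of _ _ _ "conj_S5 (inv\<^bsub>S5\<^esub> s)"])
      (use s in \<open>auto simp: conj_S5_A5 A5_subset_S5 simp flip: conj_S5_mult\<close>)
qed

lemma group_hom_A5: "f \<in> iso A5 A5 \<Longrightarrow> group_hom A5 A5 f"
  by unfold_locales (simp add: iso_def)

lemma A5_automorphism_conj:
  assumes f: "f \<in> iso A5 A5"
  obtains s where "s \<in> carrier S5" "\<And>x. x \<in> carrier A5 \<Longrightarrow> f x = conj_S5 s x"
proof -
  interpret f: group_hom A5 A5 f by (rule group_hom_A5[OF f])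
  \<comment> \<open>Injectivity of \<open>f\<close> makes it reflect, and not only preserve, the
    equations that define orders.\<close>
  have one: "f x = \<one>\<^bsub>S5\<^esub> \<longleftrightarrow> x = \<one>\<^bsub>S5\<^esub>" if "x \<in> carrier A5" for x
    using f f.iso_iff that f.hom_one by (auto simp: one_A5)
  have pow: "f x [^]\<^bsub>S5\<^esub> (n::nat) = \<one>\<^bsub>S5\<^esub> \<longleftrightarrow> x [^]\<^bsub>S5\<^esub> n = \<one>\<^bsub>S5\<^esub>" if "x \<in> carrier A5" for x n
    using one[of "x [^]\<^bsub>A5\<^esub> n"] f.hom_nat_pow[OF that, of n] that by (simp add: pow_A5[symmetric])
  have 3: "word_of (f x) \<in> set words_of_order_3 \<longleftrightarrow> word_of x \<in> set words_of_order_3"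
    if "x \<in> carrier A5" for x
    using that one pow by (simp add: word_of_in_words_of_order_3 A5_subset_S5)
  have 2: "word_involution (word_mult (word_of (f x)) (word_of (f y)))
      \<longleftrightarrow> word_involution (word_mult (word_of x) (word_of y))"
    if xy: "x \<in> carrier A5" "y \<in> carrier A5" for x y
  proof -
    have "word_mult (word_of (f x)) (word_of (f y)) = word_of (f (x \<otimes>\<^bsub>A5\<^esub> y))"
      unfolding f.hom_mult[OF xy] using xy by (simp add: mult_A5 word_of_mult A5_subset_S5)
    moreover have "word_mult (word_of x) (word_of y) = word_of (x \<otimes>\<^bsub>A5\<^esub> y)"
      using xy by (simp add: mult_A5 word_of_mult A5_subset_S5)
    moreover have "x \<otimes>\<^bsub>A5\<^esub> y \<in> carrier A5" using xy by simp
    ultimately show ?thesis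
      using one pow by (simp add: word_involution_word_of A5_subset_S5 del: A5.m_closed)
  qed
  have std3: "word_of (f x) \<in> set words_of_order_3" if "x \<in> {x3, x4, x5}" for x
  proof -
    have "x \<in> three_cycles 5" using that std_generators_three_cycles by blast
    note x = three_cycles_order_3[OF this]
    then show ?thesis unfolding 3[OF x(1)] by (simp add: word_of_in_words_of_order_3 A5_subset_S5)
  qed
  have std2: "word_involution (word_mult (word_of (f x3)) (word_of (f x4)))"
    "word_involution (word_mult (word_of (f x3)) (word_of (f x5)))"
    "word_involution (word_mult (word_of (f x4)) (word_of (f x5)))"
    using involution_products by (simp_all add: 2 Let_def)
  \<comment> \<open>The images of the standard generators satisfy the hypotheses of
    \<open>order_3_triples\<close>; its witness is the word of the conjugating permutation
    \<open>s\<close>.\<close>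
  have "\<exists>w\<in>set words. word_mult (word_of (f x3)) w = word_mult w (Word B C A D E) \<and>
      word_mult (word_of (f x4)) w = word_mult w (Word B D C A E) \<and>
      word_mult (word_of (f x5)) w = word_mult w (Word B E C D A)"
    using order_3_triples std3 std2 unfolding Let_def list_all_iff list_ex_iff by blast
  then obtain s where s: "s \<in> carrier S5"
    and eqs: "\<forall>x\<in>{x3, x4, x5}. word_mult (word_of (f x)) (word_of s) = word_mult (word_of s) (word_of x)"
    unfolding word_of_image[symmetric] by auto
  have "conj_S5 s x = f x" if x: "x \<in> {x3, x4, x5}" for x
  proof -
    have c: "x \<in> carrier S5" "f x \<in> carrier S5" using x by (auto intro: A5_subset_S5)
    then have "word_of (f x \<otimes>\<^bsub>S5\<^esub> s) = word_of (s \<otimes>\<^bsub>S5\<^esub> x)"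
      using eqs x s by (auto simp: word_of_mult)
    then show ?thesis using c s by (simp add: word_of_eq_iff conj_S5_eq_iff)
  qed
  then have "f x = conj_S5 s x" if "x \<in> carrier A5" for x
    using group_hom_eq_on_generators[OF f.group_hom_axioms group_hom_A5[OF conj_S5_iso[OF s]]
        generate_std _ that] by simp
  then show thesis using that s by blast
qed

lemma conj_S5_trivial_on_A5:
  assumes s: "s \<in> carrier S5" and "\<And>x. x \<in> carrier A5 \<Longrightarrow> conj_S5 s x = x"
  shows "s = \<one>\<^bsub>S5\<^esub>"
proof -
  have "s \<otimes>\<^bsub>S5\<^esub> x = x \<otimes>\<^bsub>S5\<^esub> s" if "x \<in> {x3, x4, x5}" for x
    using that assms by (auto simp flip: conj_S5_eq_iff)
  then have "word_mult (word_of s) (word_of x) = word_mult (word_of x) (word_of s)" if "x \<in> {x3, x4, x5}" for x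
    using that s by (metis word_of_mult std_in_S5 insertE singletonD)
  from this[of x3] this[of x4] this[of x5] have "word_of s = word_id"
    using centralizer_of_generators word_of_in_words[OF s]
    by (auto simp: Let_def list_all_iff list_ex_iff)
  then show ?thesis using s word_of_eq_iff[of s "\<one>\<^bsub>S5\<^esub>"] by (simp add: word_of_one)
qed

lemma S5_exponents:
  assumes "s \<in> carrier S5"
  shows "s [^]\<^bsub>S5\<^esub> (4::nat) = \<one>\<^bsub>S5\<^esub> \<or> s [^]\<^bsub>S5\<^esub> (5::nat) = \<one>\<^bsub>S5\<^esub> \<or> s [^]\<^bsub>S5\<^esub> (6::nat) = \<one>\<^bsub>S5\<^esub>"
  using words_exponents word_of_in_words[OF assms] assms
  by (simp add: list_all_iff flip: word_pow_eq_id_iff)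

section \<open>Regular balanced Cayley maps on \<open>A\<^sub>5\<close>\<close>

text \<open>The automorphism extending \<open>\<rho>\<close> is a conjugation by some
  \<open>s\<close>, so its iterates are conjugations by powers of \<open>s\<close>.\<close>

lemma RBCM_A5_conj:
  assumes M: "RBCM (CM A5 \<Omega> \<rho>)"
  obtains s where "s \<in> carrier S5" "\<And>k w. w \<in> \<Omega> \<Longrightarrow> (\<rho> ^^ k) w = conj_S5 (s [^]\<^bsub>S5\<^esub> k) w"
proof -
  have sub: "\<Omega> \<subseteq> carrier A5" and cyc: "cyclic_on \<rho> \<Omega>"
    using M by (simp_all add: RBCM_def cayley_map_def CM_def)
  obtain f where f: "f \<in> iso A5 A5" "\<And>w. w \<in> \<Omega> \<Longrightarrow> f w = \<rho> w"
    using RBCM_automorphism[OF M] by (auto simp: CM_def)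
  obtain s where s: "s \<in> carrier S5" "\<And>x. x \<in> carrier A5 \<Longrightarrow> f x = conj_S5 s x"
    using A5_automorphism_conj[OF f(1)] by blast
  have "(\<rho> ^^ k) w = conj_S5 (s [^]\<^bsub>S5\<^esub> k) w" if w: "w \<in> \<Omega>" for k w
  proof (induction k)
    case 0
    then show ?case using w sub by (simp add: A5_subset_S5 subsetD)
  next
    case (Suc k)
    have "(\<rho> ^^ k) w \<in> \<Omega>" using cyc w by (rule cyclic_on_funpow_in)
    then have "(\<rho> ^^ Suc k) w = conj_S5 s ((\<rho> ^^ k) w)"
      using f(2)[of "(\<rho> ^^ k) w"] s(2)[of "(\<rho> ^^ k) w"] sub by auto
    also have "\<dots> = conj_S5 (s [^]\<^bsub>S5\<^esub> Suc k) w"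
      unfolding Suc using w sub s(1) S5.nat_pow_Suc2[of s k]
      by (simp add: A5_subset_S5 subsetD flip: conj_S5_mult)
    finally show ?case .
  qed
  then show thesis using that s(1) by blast
qed

text \<open>Reduces the map to a pair \<open>(s, w)\<close> for the finite checks. The exact period
  \<open>2 * n\<close> is the cycle length of \<open>\<rho>\<close>, and the equation involving the
  \<open>n\<close>-th power of \<open>s\<close> says without inverses that this power inverts
  \<open>w\<close>.\<close>

lemma A5_conj_data:
  assumes M: "RBCM (CM A5 \<Omega> \<rho>)" "type_I (CM A5 \<Omega> \<rho>)" and card: "card \<Omega> = 2 * n"
  obtains s w where "s \<in> carrier S5" "w \<in> \<Omega>" "w \<in> carrier A5"
    "\<And>k. conj_S5 (s [^]\<^bsub>S5\<^esub> k) w = w \<longleftrightarrow> 2 * n dvd k"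
    "w \<otimes>\<^bsub>S5\<^esub> (s [^]\<^bsub>S5\<^esub> n \<otimes>\<^bsub>S5\<^esub> w) = s [^]\<^bsub>S5\<^esub> n"
    "w [^]\<^bsub>S5\<^esub> (2::nat) \<noteq> \<one>\<^bsub>S5\<^esub>"
    "\<And>k x. x \<in> \<Omega> \<Longrightarrow> (\<rho> ^^ k) x = conj_S5 (s [^]\<^bsub>S5\<^esub> k) x"
proof -
  have cm: "cayley_map (CM A5 \<Omega> \<rho>)" and bal: "balanced (CM A5 \<Omega> \<rho>)" using M by (simp_all add: RBCM_def)
  then have sub: "\<Omega> \<subseteq> carrier A5" and cyc: "cyclic_on \<rho> \<Omega>"
    by (simp_all add: cayley_map_def CM_def)
  obtain s where s: "s \<in> carrier S5"
    and conj: "\<And>k w. w \<in> \<Omega> \<Longrightarrow> (\<rho> ^^ k) w = conj_S5 (s [^]\<^bsub>S5\<^esub> k) w"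
    using RBCM_A5_conj[OF M(1)] by blast
  obtain w where w: "w \<in> \<Omega>" using cyc by (auto simp: cyclic_on_def)
  then have wA: "w \<in> carrier A5" using sub by blast
  then have wS: "w \<in> carrier S5" by (rule A5_subset_S5)
  have "conj_S5 (s [^]\<^bsub>S5\<^esub> n) w = inv\<^bsub>S5\<^esub> w"
    using balanced_funpow_inv[OF cm bal M(2) card w] conj[OF w] wA by (simp add: inv_A5)
  then have "s [^]\<^bsub>S5\<^esub> n \<otimes>\<^bsub>S5\<^esub> w = inv\<^bsub>S5\<^esub> w \<otimes>\<^bsub>S5\<^esub> s [^]\<^bsub>S5\<^esub> n"
    using s wS by (simp add: conj_S5_eq_iff)
  then have "w \<otimes>\<^bsub>S5\<^esub> (s [^]\<^bsub>S5\<^esub> n \<otimes>\<^bsub>S5\<^esub> w) = s [^]\<^bsub>S5\<^esub> n"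
    using s wS by (simp flip: S5.m_assoc)
  moreover have "w [^]\<^bsub>S5\<^esub> (2::nat) \<noteq> \<one>\<^bsub>S5\<^esub>"
    using type_I_square_neq_one[OF cm M(2) w] by (simp add: pow_A5 one_A5)
  moreover have "conj_S5 (s [^]\<^bsub>S5\<^esub> k) w = w \<longleftrightarrow> 2 * n dvd k" for k
    using cyclic_on_funpow_eq_iff[OF cyc w, of k] card conj[OF w] by simp
  ultimately show thesis using that s w wA conj by blast
qed

text \<open>A trivial power of \<open>s\<close> fixes \<open>w\<close>; hence every exponent of
  \<open>s\<close> is a multiple of the period of \<open>w\<close>.\<close>

lemma pow_eq_one_imp_dvd:
  assumes "w \<in> carrier S5" and "\<And>k. conj_S5 (s [^]\<^bsub>S5\<^esub> k) w = w \<longleftrightarrow> m dvd k"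
    and "s [^]\<^bsub>S5\<^esub> (k::nat) = \<one>\<^bsub>S5\<^esub>"
  shows "m dvd k"
  using assms(2)[of k] assms(1,3) by simp

text \<open>Conjugation by \<open>t\<close> turns \<open>s\<close> into \<open>s0\<close> and
  \<open>w\<close> into \<open>w0\<close>. So it carries the orbit of \<open>w\<close> under
  \<open>s\<close>, which is all of \<open>\<Omega>\<close>, onto the orbit of \<open>w0\<close>
  under \<open>s0\<close>, and it intertwines the rotations.\<close>

lemma cm_isomorphic_CM_conj:
  assumes M: "cayley_map (CM A5 \<Omega> \<rho>)" and s: "s \<in> carrier S5" and w: "w \<in> \<Omega>"
    and conj: "\<And>k x. x \<in> \<Omega> \<Longrightarrow> (\<rho> ^^ k) x = conj_S5 (s [^]\<^bsub>S5\<^esub> k) x"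
    and t: "t \<in> carrier S5" and s0: "s0 \<in> carrier S5"
    and ts: "t \<otimes>\<^bsub>S5\<^esub> s = s0 \<otimes>\<^bsub>S5\<^esub> t" and tw: "conj_S5 t w = w0"
  shows "cm_isomorphic (CM A5 \<Omega> \<rho>) (CM_conj s0 w0)"
proof -
  have sub: "\<Omega> \<subseteq> carrier A5" and cyc: "cyclic_on \<rho> \<Omega>"
    using M by (simp_all add: cayley_map_def CM_def)
  have inS: "x \<in> carrier S5" if "x \<in> \<Omega>" for x using that sub A5_subset_S5 by blast
  have "t \<otimes>\<^bsub>S5\<^esub> s [^]\<^bsub>S5\<^esub> k = s0 [^]\<^bsub>S5\<^esub> k \<otimes>\<^bsub>S5\<^esub> t" for k :: nat
  proof (induction k)
    case (Suc k)
    have "t \<otimes>\<^bsub>S5\<^esub> s [^]\<^bsub>S5\<^esub> Suc k = s0 [^]\<^bsub>S5\<^esub> k \<otimes>\<^bsub>S5\<^esub> t \<otimes>\<^bsub>S5\<^esub> s"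
      using s t by (simp flip: S5.m_assoc Suc)
    also have "\<dots> = s0 [^]\<^bsub>S5\<^esub> Suc k \<otimes>\<^bsub>S5\<^esub> t"
      using s t s0 ts by (simp add: S5.m_assoc)
    finally show ?case .
  qed (use t in simp)
  then have equi: "conj_S5 t (conj_S5 (s [^]\<^bsub>S5\<^esub> k) x) = conj_S5 (s0 [^]\<^bsub>S5\<^esub> k) (conj_S5 t x)"
    if "x \<in> \<Omega>" for x and k :: nat
    using inS[OF that] s s0 t conj_S5_mult[of t "s [^]\<^bsub>S5\<^esub> k" x] conj_S5_mult[of "s0 [^]\<^bsub>S5\<^esub> k" t x]
    by simp
  have Omega: "\<Omega> = {conj_S5 (s [^]\<^bsub>S5\<^esub> k) w | k :: nat. True}"
  proof (intro Set.equalityI subsetI)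
    fix x assume "x \<in> \<Omega>"
    then obtain k where "x = (\<rho> ^^ k) w" by (rule cyclic_on_obtain_funpow[OF cyc w])
    then show "x \<in> {conj_S5 (s [^]\<^bsub>S5\<^esub> k) w | k :: nat. True}" using conj[OF w] by blast
  next
    fix x assume "x \<in> {conj_S5 (s [^]\<^bsub>S5\<^esub> k) w | k :: nat. True}"
    then show "x \<in> \<Omega>" using cyclic_on_funpow_in[OF cyc w] by (auto simp flip: conj[OF w])
  qed
  have "conj_orbit s0 w0 = {conj_S5 t (conj_S5 (s [^]\<^bsub>S5\<^esub> k) w) | k :: nat. True}"
    using tw by (simp add: conj_orbit_def equi[OF w])
  also have "\<dots> = conj_S5 t ` \<Omega>" by (subst Omega) blast
  finally have orbit: "conj_orbit s0 w0 = conj_S5 t ` \<Omega>" .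
  show ?thesis
  proof (rule cm_isomorphic_if_group_iso[OF M, of _ "conj_S5 t"])
    fix x assume "x \<in> cm_gens (CM A5 \<Omega> \<rho>)"
    then have x: "x \<in> \<Omega>" by (simp add: CM_def)
    then show "cm_rot (CM_conj s0 w0) (conj_S5 t x) = conj_S5 t (cm_rot (CM A5 \<Omega> \<rho>) x)"
      using equi[OF x, of 1] conj[OF x, of 1] s s0
      by (simp add: CM_conj_def CM_def perm_restrict_def orbit)
  qed (use t orbit in \<open>simp_all add: CM_conj_def CM_def perm_restrict_def group_A5 conj_S5_iso\<close>)
qed

text \<open>With period 4, \<open>\<Omega>\<close> consists of \<open>w\<close>, its conjugate by
  \<open>s\<close> and the inverses of these two. If the two commuted, conjugation by
  \<open>w\<close> would fix all generators and hence \<open>A5\<close>, forcing \<open>w\<close> to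
  be the identity.\<close>

lemma conj_generators_noncommuting:
  assumes M: "cayley_map (CM A5 \<Omega> \<rho>)" and s: "s \<in> carrier S5" and w: "w \<in> \<Omega>"
    and conj: "\<And>k x. x \<in> \<Omega> \<Longrightarrow> (\<rho> ^^ k) x = conj_S5 (s [^]\<^bsub>S5\<^esub> k) x"
    and card: "card \<Omega> = 4" and inv: "conj_S5 (s [^]\<^bsub>S5\<^esub> (2::nat)) w = inv\<^bsub>S5\<^esub> w"
  shows "conj_S5 w (conj_S5 s w) \<noteq> conj_S5 s w"
proof
  assume comm: "conj_S5 w (conj_S5 s w) = conj_S5 s w"
  have sub: "\<Omega> \<subseteq> carrier A5" and cyc: "cyclic_on \<rho> \<Omega>" and one: "\<one>\<^bsub>A5\<^esub> \<notin> \<Omega>"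
    and gen: "generate A5 \<Omega> = carrier A5"
    using M by (simp_all add: cayley_map_def CM_def)
  have wA: "w \<in> carrier A5" and wS: "w \<in> carrier S5" using w sub A5_subset_S5 by blast+
  interpret c: group_hom A5 A5 "conj_S5 w" by (rule group_hom_A5[OF conj_S5_iso[OF wS]])
  have "conj_S5 w x = x" if x: "x \<in> \<Omega>" for x
  proof -
    obtain k where "x = (\<rho> ^^ k) w" by (rule cyclic_on_obtain_funpow[OF cyc w x])
    moreover have "(\<rho> ^^ 4) w = w" using cyclic_on_funpow_eq_iff[OF cyc w, of 4] card by simp
    ultimately have "x = (\<rho> ^^ (k mod 4)) w" by (simp add: funpow_mod_eq)
    moreover have "k mod 4 \<in> {0, 1, 2, 3}" by auto
    ultimately have "x \<in> {w, (\<rho> ^^ 1) w, (\<rho> ^^ 2) w, (\<rho> ^^ 3) w}" by auto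
    moreover have r1: "(\<rho> ^^ 1) w = conj_S5 s w" unfolding conj[OF w] using s by simp
    moreover have "(\<rho> ^^ 2) w = inv\<^bsub>A5\<^esub> w" unfolding conj[OF w] inv using wA by (simp add: inv_A5)
    moreover have "(\<rho> ^^ 3) w = inv\<^bsub>A5\<^esub> (conj_S5 s w)"
    proof -
      interpret d: group_hom A5 A5 "conj_S5 s" by (rule group_hom_A5[OF conj_S5_iso[OF s]])
      have "(\<rho> ^^ 3) w = conj_S5 s (conj_S5 (s [^]\<^bsub>S5\<^esub> (2::nat)) w)"
        unfolding conj[OF w] using s wS S5.nat_pow_Suc2[of s 2]
        by (simp add: numeral_3_eq_3 numeral_2_eq_2 flip: conj_S5_mult)
      then show ?thesis using d.hom_inv[OF wA] wA by (simp add: inv inv_A5)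
    qed
    moreover have "conj_S5 w w = w" using wS by (simp add: conj_S5_eq_iff)
    ultimately show ?thesis using comm c.hom_inv wA conj_S5_A5[OF s wA] by auto
  qed
  then have "conj_S5 w x = x" if "x \<in> carrier A5" for x
    using group_hom_eq_on_generators[of A5 A5 "conj_S5 w" "\<lambda>x. x" \<Omega> x] c.group_hom_axioms gen that
      group_hom_A5[OF iso_set_refl] by blast
  then have "w = \<one>\<^bsub>A5\<^esub>" using conj_S5_trivial_on_A5[OF wS] by (simp add: one_A5)
  then show False using w one by simp
qed

section \<open>Classification by valency\<close>

lemma word_of_standard:
  "cycle_of_list [1, 4, 2, 5] \<in> carrier S5" "word_of (cycle_of_list [1, 4, 2, 5]) = Word D E C B A"
  "cycle_of_list [1, 2] \<otimes>\<^bsub>S5\<^esub> cycle_of_list [3, 4, 5] \<in> carrier S5"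
  "word_of (cycle_of_list [1, 2] \<otimes>\<^bsub>S5\<^esub> cycle_of_list [3, 4, 5]) = Word B A D E C"
proof -
  have "cycle_of_list cs \<in> carrier S5" if "set cs \<subseteq> {1..5}" for cs
    using permutes_subset[OF cycle_permutes that] by (simp add: carrier_S5)
  then show "cycle_of_list [1, 4, 2, 5] \<in> carrier S5"
    "cycle_of_list [1, 2] \<otimes>\<^bsub>S5\<^esub> cycle_of_list [3, 4, 5] \<in> carrier S5"
    by (auto intro!: S5.m_closed simp del: cycle_of_list.simps)
qed (simp_all add: word_of_def point_of_def mult_S5 transpose_def)

lemma conjugator_if_word_conjugator:
  assumes c: "s \<in> carrier S5" "w \<in> carrier S5" "s0 \<in> carrier S5" "w0 \<in> carrier S5"
    and "\<exists>u\<in>set words. word_mult u (word_of s) = word_mult (word_of s0) u \<and>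
      word_mult u (word_of w) = word_mult (word_of w0) u"
  shows "\<exists>t\<in>carrier S5. t \<otimes>\<^bsub>S5\<^esub> s = s0 \<otimes>\<^bsub>S5\<^esub> t \<and> conj_S5 t w = w0"
proof -
  obtain t where t: "t \<in> carrier S5" "word_mult (word_of t) (word_of s) = word_mult (word_of s0) (word_of t)"
      "word_mult (word_of t) (word_of w) = word_mult (word_of w0) (word_of t)"
    using assms(5) unfolding word_of_image[symmetric] by blast
  then have "word_of (t \<otimes>\<^bsub>S5\<^esub> s) = word_of (s0 \<otimes>\<^bsub>S5\<^esub> t)" "word_of (t \<otimes>\<^bsub>S5\<^esub> w) = word_of (w0 \<otimes>\<^bsub>S5\<^esub> t)"
    using c by (simp_all add: word_of_mult)
  then show ?thesis using t(1) c by (intro bexI[of _ t]) (simp_all add: word_of_eq_iff conj_S5_eq_iff)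
qed

lemma order_4_conjugator:
  assumes "s \<in> set words" "word_pow s 4 = word_id" "word_pow s 2 \<noteq> word_id"
    and "w \<in> set words" "alternating w" "word_pow w 2 \<noteq> word_id"
    and "word_mult w (word_mult (word_pow s 2) w) = word_pow s 2"
    and "word_mult (word_mult (word_mult s w) (word_pow s 3)) w
      \<noteq> word_mult w (word_mult (word_mult s w) (word_pow s 3))"
  shows "\<exists>u\<in>set words. word_mult u s = word_mult (Word D E C B A) u \<and>
    word_mult u w = word_mult (Word B C A D E) u"
  using bspec[OF order_4_pairs[unfolded Let_def list_all_iff list_ex_iff set_filter] assms(1)] assms(2-)
  by auto

lemma order_6_conjugator:
  assumes "s \<in> set words" "word_pow s 6 = word_id" "word_pow s 2 \<noteq> word_id" "word_pow s 3 \<noteq> word_id"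
    and "w \<in> set words" "alternating w" "word_pow w 2 \<noteq> word_id"
    and "word_mult w (word_mult (word_pow s 3) w) = word_pow s 3"
  shows "\<exists>u\<in>set words. word_mult u s = word_mult (Word B A D E C) u \<and>
    word_mult u w = word_mult (Word B C A D E) u"
  using bspec[OF order_6_pairs[unfolded Let_def list_all_iff list_ex_iff set_filter] assms(1)] assms(2-)
  by auto

lemma four_valent:
  assumes M: "RBCM (CM A5 \<Omega> \<rho>)" "type_I (CM A5 \<Omega> \<rho>)" and card: "card \<Omega> = 4"
  shows "cm_isomorphic (CM A5 \<Omega> \<rho>) (CM_conj (cycle_of_list [1, 4, 2, 5]) (cycle_of_list [1, 2, 3]))"
proof -
  have cm: "cayley_map (CM A5 \<Omega> \<rho>)" using M by (simp add: RBCM_def)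
  have card': "card \<Omega> = 2 * 2" using card by simp
  obtain s w where s: "s \<in> carrier S5" and w: "w \<in> \<Omega>" "w \<in> carrier A5"
    and period: "\<And>k. conj_S5 (s [^]\<^bsub>S5\<^esub> k) w = w \<longleftrightarrow> 2 * 2 dvd (k::nat)"
    and inv: "w \<otimes>\<^bsub>S5\<^esub> (s [^]\<^bsub>S5\<^esub> (2::nat) \<otimes>\<^bsub>S5\<^esub> w) = s [^]\<^bsub>S5\<^esub> (2::nat)"
    and w2: "w [^]\<^bsub>S5\<^esub> (2::nat) \<noteq> \<one>\<^bsub>S5\<^esub>"
    and conj: "\<And>k x. x \<in> \<Omega> \<Longrightarrow> (\<rho> ^^ k) x = conj_S5 (s [^]\<^bsub>S5\<^esub> k) x"
    using A5_conj_data[OF M card'] by blast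
  have wS: "w \<in> carrier S5" using w(2) by (rule A5_subset_S5)
  note dvd = pow_eq_one_imp_dvd[OF wS period]
  \<comment> \<open>Every exponent of \<open>s\<close> is a multiple of 4, which rules out 5 and
    6.\<close>
  have s4: "s [^]\<^bsub>S5\<^esub> (4::nat) = \<one>\<^bsub>S5\<^esub>" using S5_exponents[OF s] dvd[of 5] dvd[of 6] by auto
  have s2: "s [^]\<^bsub>S5\<^esub> (2::nat) \<noteq> \<one>\<^bsub>S5\<^esub>" using dvd[of 2] by auto
  have "conj_S5 (s [^]\<^bsub>S5\<^esub> (2::nat)) w = inv\<^bsub>S5\<^esub> w"
    using inv s wS by (simp add: conj_S5_eq_iff S5.inv_solve_left)
  note nc = conj_generators_noncommuting[OF cm s w(1) conj card this]
  define c where "c = s \<otimes>\<^bsub>S5\<^esub> w \<otimes>\<^bsub>S5\<^esub> s [^]\<^bsub>S5\<^esub> (3::nat)"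
  have cS: "c \<in> carrier S5" using s wS by (simp add: c_def)
  \<comment> \<open>As the fourth power of \<open>s\<close> is trivial, \<open>c\<close> is the
    conjugate of \<open>w\<close> by \<open>s\<close>, in a form that translates into words.\<close>
  have "s [^]\<^bsub>S5\<^esub> (3::nat) = inv\<^bsub>S5\<^esub> s"
    using s s4 by (intro S5.inv_equality[symmetric]) (simp_all add: numeral_eq_Suc)
  then have "c = conj_S5 s w" by (simp add: c_def conj_S5_def)
  with nc have "c \<otimes>\<^bsub>S5\<^esub> w \<noteq> w \<otimes>\<^bsub>S5\<^esub> c" using s wS cS by (simp add: conj_S5_eq_iff)
  then have nc: "word_mult (word_of c) (word_of w) \<noteq> word_mult (word_of w) (word_of c)"
    using s wS cS by (simp add: word_of_eq_iff flip: word_of_mult)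
  have c: "word_of c = word_mult (word_mult (word_of s) (word_of w)) (word_pow (word_of s) 3)"
    using s wS by (simp add: c_def word_of_mult word_of_pow)
  have inv': "word_mult (word_of w) (word_mult (word_pow (word_of s) 2) (word_of w)) = word_pow (word_of s) 2"
    using arg_cong[OF inv, of word_of] s wS by (simp add: word_of_mult word_of_pow)
  have "\<exists>u\<in>set words. word_mult u (word_of s) = word_mult (Word D E C B A) u \<and>
      word_mult u (word_of w) = word_mult (Word B C A D E) u"
    by (rule order_4_conjugator)
      (use s wS s4 s2 w2 inv' nc[unfolded c] in
        \<open>simp_all add: word_pow_eq_id_iff word_of_in_words alternating_word_of[OF w(2)]\<close>)
  then obtain t where "t \<in> carrier S5" "t \<otimes>\<^bsub>S5\<^esub> s = cycle_of_list [1, 4, 2, 5] \<otimes>\<^bsub>S5\<^esub> t"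
      "conj_S5 t w = cycle_of_list [1, 2, 3]"
    using conjugator_if_word_conjugator[OF s wS word_of_standard(1) std_in_S5(1),
        unfolded word_of_standard(2) word_of_std(1), unfolded x3_def] by blast
  then show ?thesis using cm_isomorphic_CM_conj[OF cm s w(1) conj] word_of_standard(1) by blast
qed

lemma six_valent:
  assumes M: "RBCM (CM A5 \<Omega> \<rho>)" "type_I (CM A5 \<Omega> \<rho>)" and card: "card \<Omega> = 6"
  shows "cm_isomorphic (CM A5 \<Omega> \<rho>)
    (CM_conj (cycle_of_list [1, 2] \<otimes>\<^bsub>S5\<^esub> cycle_of_list [3, 4, 5]) (cycle_of_list [1, 2, 3]))"
proof -
  have cm: "cayley_map (CM A5 \<Omega> \<rho>)" using M by (simp add: RBCM_def)
  have card': "card \<Omega> = 2 * 3" using card by simp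
  obtain s w where s: "s \<in> carrier S5" and w: "w \<in> \<Omega>" "w \<in> carrier A5"
    and period: "\<And>k. conj_S5 (s [^]\<^bsub>S5\<^esub> k) w = w \<longleftrightarrow> 2 * 3 dvd (k::nat)"
    and inv: "w \<otimes>\<^bsub>S5\<^esub> (s [^]\<^bsub>S5\<^esub> (3::nat) \<otimes>\<^bsub>S5\<^esub> w) = s [^]\<^bsub>S5\<^esub> (3::nat)"
    and w2: "w [^]\<^bsub>S5\<^esub> (2::nat) \<noteq> \<one>\<^bsub>S5\<^esub>"
    and conj: "\<And>k x. x \<in> \<Omega> \<Longrightarrow> (\<rho> ^^ k) x = conj_S5 (s [^]\<^bsub>S5\<^esub> k) x"
    using A5_conj_data[OF M card'] by blast
  have wS: "w \<in> carrier S5" using w(2) by (rule A5_subset_S5)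
  note dvd = pow_eq_one_imp_dvd[OF wS period]
  \<comment> \<open>Every exponent of \<open>s\<close> is a multiple of 6, which rules out 4 and 5,
    and below also 2 and 3, so \<open>s\<close> has order exactly 6.\<close>
  have s6: "s [^]\<^bsub>S5\<^esub> (6::nat) = \<one>\<^bsub>S5\<^esub>" using S5_exponents[OF s] dvd[of 4] dvd[of 5] by auto
  have s2: "s [^]\<^bsub>S5\<^esub> (2::nat) \<noteq> \<one>\<^bsub>S5\<^esub>" using dvd[of 2] by auto
  have s3: "s [^]\<^bsub>S5\<^esub> (3::nat) \<noteq> \<one>\<^bsub>S5\<^esub>" using dvd[of 3] by auto
  have inv': "word_mult (word_of w) (word_mult (word_pow (word_of s) 3) (word_of w)) = word_pow (word_of s) 3"
    using arg_cong[OF inv, of word_of] s wS by (simp add: word_of_mult word_of_pow)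
  have "\<exists>u\<in>set words. word_mult u (word_of s) = word_mult (Word B A D E C) u \<and>
      word_mult u (word_of w) = word_mult (Word B C A D E) u"
    by (rule order_6_conjugator)
      (use s wS s6 s2 s3 w2 inv' in
        \<open>simp_all add: word_pow_eq_id_iff word_of_in_words alternating_word_of[OF w(2)]\<close>)
  then obtain t where "t \<in> carrier S5"
      "t \<otimes>\<^bsub>S5\<^esub> s = (cycle_of_list [1, 2] \<otimes>\<^bsub>S5\<^esub> cycle_of_list [3, 4, 5]) \<otimes>\<^bsub>S5\<^esub> t"
      "conj_S5 t w = cycle_of_list [1, 2, 3]"
    using conjugator_if_word_conjugator[OF s wS word_of_standard(3) std_in_S5(1),
        unfolded word_of_standard(4) word_of_std(1), unfolded x3_def] by blast
  then show ?thesis using cm_isomorphic_CM_conj[OF cm s w(1) conj] word_of_standard(3) by blast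
qed

text \<open>The period \<open>2 * n\<close> divides every exponent of \<open>s\<close>, and one of
  4, 5 and 6 is such an exponent.\<close>

lemma valency_bound:
  assumes M: "RBCM (CM A5 \<Omega> \<rho>)" "type_I (CM A5 \<Omega> \<rho>)" and card: "card \<Omega> = 2 * n"
  shows "n \<le> 3"
proof -
  obtain s w where s: "s \<in> carrier S5" and w: "w \<in> carrier A5"
    and period: "\<And>k. conj_S5 (s [^]\<^bsub>S5\<^esub> k) w = w \<longleftrightarrow> 2 * n dvd k"
    by (rule A5_conj_data[OF M card]) (rule that)
  note dvd = pow_eq_one_imp_dvd[OF A5_subset_S5[OF w] period]
  have "2 * n dvd 4 \<or> 2 * n dvd 5 \<or> 2 * n dvd 6"
    using S5_exponents[OF s] dvd[of 4] dvd[of 5] dvd[of 6] by blast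
  then have "2 * n \<le> 6" by (elim disjE; drule_tac dvd_imp_le) simp_all
  then show ?thesis by simp
qed

theorem theorem3p1:
  shows "(\<forall>\<Omega> \<rho>. RBCM (CM A5 \<Omega> \<rho>) \<and> type_I (CM A5 \<Omega> \<rho>) \<and> valency (CM A5 \<Omega> \<rho>) = 4 \<longrightarrow>
            cm_isomorphic (CM A5 \<Omega> \<rho>)
              (CM_conj (cycle_of_list [1, 4, 2, 5]) (cycle_of_list [1, 2, 3])))
       \<and> (\<forall>\<Omega> \<rho>. RBCM (CM A5 \<Omega> \<rho>) \<and> type_I (CM A5 \<Omega> \<rho>) \<and> valency (CM A5 \<Omega> \<rho>) = 6 \<longrightarrow>
            cm_isomorphic (CM A5 \<Omega> \<rho>)
              (CM_conj (cycle_of_list [1, 2] \<otimes>\<^bsub>S5\<^esub> cycle_of_list [3, 4, 5]) (cycle_of_list [1, 2, 3])))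
       \<and> (\<forall>n > 3. \<not> (\<exists>\<Omega> \<rho>. RBCM (CM A5 \<Omega> \<rho>) \<and> type_I (CM A5 \<Omega> \<rho>) \<and>
            valency (CM A5 \<Omega> \<rho>) = 2 * n))"
proof -
  have "valency (CM A5 \<Omega> \<rho>) = card \<Omega>" for \<Omega> \<rho>
    by (simp add: valency_def CM_def)
  then show ?thesis using four_valent six_valent valency_bound by (auto simp flip: not_le)
qed

end
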